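(* (1) Let $u\in\mathcal{C}(\mathbb{R}^d)\cap L^1(\omega)$ be a viscosity solution of $$\mathbf{I}u+\Lambda^+u=0\ \text{in }\Omega,\qquad u=0\ \text{in }\Omega^c,$$ or of $$\mathbf{I}u+\Lambda^+u\ge0\ \text{in }\Omega,\qquad u(x_0)>0,\qquad u\le0\ \text{in }\Omega^c,$$ for some $x_0\in\Omega$. Then $u=t\Psi^+$ for some $t\in\mathbb{R}$. (2) Similarly, let $u\in\mathcal{C}(\mathbb{R}^d)\cap L^1(\omega)$ be a viscosity solution of $$\mathbf{I}u+\Lambda^-u=0\ \text{in }\Omega,\qquad u=0\ \text{in }\Omega^c,$$ or of $$\mathbf{I}u+\Lambda^-u\le0\ \text{in }\Omega,\qquad u(x_0)<0,\qquad u\ge0\ \text{in }\Omega^c,$$ for some $x_0\in\Omega$. Then $u=t\Psi^-$ for some $t\in\mathbb{R}$.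
   Context: Fix the dimension $d$, $s\in(0,1)$ and $0<\lambda\le\Lambda$. Let $\mathcal{L}_*$ be the class of all operators $$Lu(x)=\frac12\int_{\mathbb{R}^d}\bigl(u(x+y)+u(x-y)-2u(x)\bigr)\frac{k(y/|y|)}{|y|^{d+2s}}\,dy,$$ where $k\in L^\infty(S^{d-1})$, $\lambda\le k\le\Lambda$ and $k(y)=k(-y)$. Let $\mathcal{L}\subset\mathcal{L}_*$ be a nonempty subclass and $\mathbf{I}u=\sup_{L\in\mathcal{L}}Lu$. $\Omega\subset\mathbb{R}^d$ is a bounded (connected) domain with smooth boundary. $L^1(\omega)$ is the set of functions integrable with respect to the weight $\omega(y)=(1+|y|)^{-d-2s}$. All (in)equalities are in the viscosity sense: $\mathbf{I}u\ge f$ in $\Omega$ means that whenever $x_0\in\Omega$, $N\subset\Omega$ is a neighbourhood of $x_0$, and $\varphi\in\mathcal{C}^2(\bar N)$ satisfies $\varphi(x_0)=u(x_0)$ and $\varphi>u$ in $N\setminus\{x_0\}$, the function $v$ equal to $\varphi$ in $N$ and $u$ in $N^c$ satisfies $\mathbf{I}v(x_0)\ge f(x_0)$; $\mathbf{I}u\le f$ is defined symmetrically (touching from below, reversed inequality), and $\mathbf{I}u=f$ means both. Define $$\Lambda^+=\sup\{\mu\in\mathbb{R}:\exists\,\psi\in\mathcal{C}(\mathbb{R}^d)\cap L^1(\omega),\ \psi\ge0,\ \psi>0\text{ in }\Omega,\ \mathbf{I}\psi+\mu\psi\le0\text{ in }\Omega\},$$ $$\Lambda^-=\sup\{\mu\in\mathbb{R}:\exists\,\psi\in\mathcal{C}(\mathbb{R}^d)\cap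 L^1(\omega),\ \psi\le0,\ \psi<0\text{ in }\Omega,\ \mathbf{I}\psi+\mu\psi\ge0\text{ in }\Omega\}.$$ $\mathcal{C}_0(\Omega)$: continuous functions on $\mathbb{R}^d$ vanishing on $\Omega^c$. $\mathcal{C}^{2s+}(\Omega)$: continuous functions $f$ on $\mathbb{R}^d$ such that for each compact $K\subset\Omega$ there is $\alpha>0$ with $f\in\mathcal{C}^{2s+\alpha}(K)$. $\Psi^+,\Psi^-\in\mathcal{C}^{2s+}(\Omega)\cap\mathcal{C}_0(\Omega)$ denote principal eigenfunctions: $\mathbf{I}\Psi^\pm=-\Lambda^\pm\Psi^\pm$ in $\Omega$, with $\Psi^+>0$ and $\Psi^-<0$ in $\Omega$. *)

theory Defs
  imports "HOL-Analysis.Analysis"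
begin

section \<open>Spaces of differentiable functions\<close>

definition partial_deriv :: "'a::euclidean_space \<Rightarrow> ('a \<Rightarrow> real) \<Rightarrow> 'a \<Rightarrow> real" where
  "partial_deriv i f x = frechet_derivative f (at x) i"

primrec C_on :: "nat \<Rightarrow> ('a::euclidean_space \<Rightarrow> real) \<Rightarrow> 'a set \<Rightarrow> bool" where
  "C_on 0 f U \<longleftrightarrow> continuous_on U f"
| "C_on (Suc k) f U \<longleftrightarrow>
     (\<forall>x\<in>U. f differentiable (at x)) \<and> (\<forall>i\<in>Basis. C_on k (partial_deriv i f) U)"

text \<open>\<open>C\<^sup>k\<close> up to the boundary, for open \<open>N\<close>: all partial derivatives of order at most \<open>k\<close>
  exist in \<open>N\<close> and extend continuously to \<open>closure N\<close>.  Only the values of \<open>f\<close> on \<open>N\<close> matter.\<close>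

definition extends_continuously :: "('a::euclidean_space \<Rightarrow> real) \<Rightarrow> 'a set \<Rightarrow> bool" where
  "extends_continuously f N \<longleftrightarrow>
     (\<exists>g. continuous_on (closure N) g \<and> (\<forall>x\<in>N. g x = f x))"

primrec C_closure :: "nat \<Rightarrow> ('a::euclidean_space \<Rightarrow> real) \<Rightarrow> 'a set \<Rightarrow> bool" where
  "C_closure 0 f N \<longleftrightarrow> extends_continuously f N"
| "C_closure (Suc k) f N \<longleftrightarrow> extends_continuously f N \<and>
     (\<forall>x\<in>N. f differentiable (at x)) \<and> (\<forall>i\<in>Basis. C_closure k (partial_deriv i f) N)"

primrec holder_derivs :: "nat \<Rightarrow> real \<Rightarrow> ('a::euclidean_space \<Rightarrow> real) \<Rightarrow> 'a set \<Rightarrow> bool" where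
  "holder_derivs 0 \<gamma> f K \<longleftrightarrow>
     (\<exists>C. \<forall>x\<in>K. \<forall>y\<in>K. \<bar>f x - f y\<bar> \<le> C * norm (x - y) powr \<gamma>)"
| "holder_derivs (Suc m) \<gamma> f K \<longleftrightarrow> (\<forall>i\<in>Basis. holder_derivs m \<gamma> (partial_deriv i f) K)"

text \<open>\<open>C\<^sup>\<beta>(K)\<close> for compact \<open>K\<close> and \<open>\<beta> > 0\<close>: writing \<open>\<beta> = m + \<gamma>\<close> with \<open>0 < \<gamma> \<le> 1\<close>, the function
  is \<open>C\<^sup>m\<close> near \<open>K\<close> and its derivatives of order \<open>m\<close> are \<open>\<gamma>\<close>-Hoelder on \<open>K\<close>.  The convention at
  integer \<open>\<beta>\<close> is immaterial in \<open>C_2s_plus\<close>, where \<open>\<alpha>\<close> can always be decreased.\<close>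

definition holder_space :: "real \<Rightarrow> ('a::euclidean_space \<Rightarrow> real) \<Rightarrow> 'a set \<Rightarrow> bool" where
  "holder_space \<beta> f K \<longleftrightarrow>
     (let m = nat (\<lceil>\<beta>\<rceil> - 1); \<gamma> = \<beta> - real m in
        (\<exists>U. open U \<and> K \<subseteq> U \<and> C_on m f U) \<and> holder_derivs m \<gamma> f K)"

definition C_2s_plus :: "real \<Rightarrow> 'a::euclidean_space set \<Rightarrow> ('a \<Rightarrow> real) set" where
  "C_2s_plus s \<Omega> = {f. continuous_on UNIV f \<and>
     (\<forall>K. compact K \<and> K \<subseteq> \<Omega> \<longrightarrow> (\<exists>\<alpha>>0. holder_space (2 * s + \<alpha>) f K))}"

definition C_zero :: "'a::euclidean_space set \<Rightarrow> ('a \<Rightarrow> real) set" where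
  "C_zero \<Omega> = {f. continuous_on UNIV f \<and> (\<forall>x. x \<notin> \<Omega> \<longrightarrow> f x = 0)}"

definition L1_omega :: "real \<Rightarrow> ('a::euclidean_space \<Rightarrow> real) set" where
  "L1_omega s =
     {u. integrable lebesgue (\<lambda>y. u y * (1 + norm y) powr (- (real DIM('a) + 2 * s)))}"


section \<open>Smooth bounded domains\<close>

text \<open>The boundary is locally the graph of a smooth function \<open>\<gamma>\<close> over a hyperplane with unit
  normal \<open>e\<close>, with \<open>\<Omega>\<close> on one side of it; \<open>\<gamma>\<close> is defined on the whole space, but only its values
  on the hyperplane are used.\<close>

definition smooth_boundary :: "'a::euclidean_space set \<Rightarrow> bool" where
  "smooth_boundary \<Omega> \<longleftrightarrow>
     (\<forall>x0\<in>frontier \<Omega>. \<exists>r>0. \<exists>e \<gamma>. norm e = 1 \<and> (\<forall>k. C_on k \<gamma> UNIV) \<and>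
        \<Omega> \<inter> ball x0 r = {x \<in> ball x0 r. x \<bullet> e > \<gamma> (x - (x \<bullet> e) *\<^sub>R e)})"

definition smooth_bounded_domain :: "'a::euclidean_space set \<Rightarrow> bool" where
  "smooth_bounded_domain \<Omega> \<longleftrightarrow>
     \<Omega> \<noteq> {} \<and> open \<Omega> \<and> connected \<Omega> \<and> bounded \<Omega> \<and> smooth_boundary \<Omega>"


section \<open>The operators\<close>

text \<open>\<open>k \<in> L\<^sup>\<infinity>(S\<^bsup>d-1\<^esup>)\<close>, even, with \<open>lam \<le> k \<le> Lam\<close>, all up to null sets of the surface measure.
  By polar coordinates, measurability on the sphere and surface-null sets are those of the
  0-homogeneous extension \<open>y \<mapsto> k (y / norm y)\<close> with respect to Lebesgue measure.\<close>

definition kernel_class :: "real \<Rightarrow> real \<Rightarrow> ('a::euclidean_space \<Rightarrow> real) set" where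
  "kernel_class lam Lam = {k.
     (\<lambda>y. k (y /\<^sub>R norm y)) \<in> borel_measurable lebesgue \<and>
     (AE y in lebesgue. lam \<le> k (y /\<^sub>R norm y) \<and> k (y /\<^sub>R norm y) \<le> Lam) \<and>
     (AE y in lebesgue. k (- (y /\<^sub>R norm y)) = k (y /\<^sub>R norm y))}"

definition L_op :: "real \<Rightarrow> ('a::euclidean_space \<Rightarrow> real) \<Rightarrow> ('a \<Rightarrow> real) \<Rightarrow> 'a \<Rightarrow> real" where
  "L_op s k u x = 1 / 2 * (LINT y|lebesgue.
     (u (x + y) + u (x - y) - 2 * u x) *
     (k (y /\<^sub>R norm y) / norm y powr (real DIM('a) + 2 * s)))"

definition L_star ::
  "real \<Rightarrow> real \<Rightarrow> real \<Rightarrow> (('a::euclidean_space \<Rightarrow> real) \<Rightarrow> 'a \<Rightarrow> real) set" where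
  "L_star s lam Lam = L_op s ` kernel_class lam Lam"

text \<open>The integral in \<open>L_op\<close> and the supremum below are real-valued.  They are only ever evaluated
  at points near which the function is \<open>C\<^sup>2\<close>, for functions in \<open>L1_omega s\<close>; there the integrals
  converge absolutely and are bounded uniformly over \<open>L_star s lam Lam\<close>.\<close>

definition I_op :: "(('a::euclidean_space \<Rightarrow> real) \<Rightarrow> 'a \<Rightarrow> real) set \<Rightarrow> ('a \<Rightarrow> real) \<Rightarrow> 'a \<Rightarrow> real"
  where "I_op \<L> u x = (SUP L\<in>\<L>. L u x)"


section \<open>Viscosity inequalities\<close>

definition visc_ge :: "(('a::euclidean_space \<Rightarrow> real) \<Rightarrow> 'a \<Rightarrow> real) set \<Rightarrow> 'a set \<Rightarrow>
    ('a \<Rightarrow> real) \<Rightarrow> ('a \<Rightarrow> real) \<Rightarrow> bool" where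
  "visc_ge \<L> \<Omega> u f \<longleftrightarrow>
     (\<forall>x0\<in>\<Omega>. \<forall>N \<phi>. open N \<and> x0 \<in> N \<and> N \<subseteq> \<Omega> \<and> C_closure 2 \<phi> N \<and>
        \<phi> x0 = u x0 \<and> (\<forall>x\<in>N - {x0}. \<phi> x > u x) \<longrightarrow>
        I_op \<L> (\<lambda>x. if x \<in> N then \<phi> x else u x) x0 \<ge> f x0)"

definition visc_le :: "(('a::euclidean_space \<Rightarrow> real) \<Rightarrow> 'a \<Rightarrow> real) set \<Rightarrow> 'a set \<Rightarrow>
    ('a \<Rightarrow> real) \<Rightarrow> ('a \<Rightarrow> real) \<Rightarrow> bool" where
  "visc_le \<L> \<Omega> u f \<longleftrightarrow>
     (\<forall>x0\<in>\<Omega>. \<forall>N \<phi>. open N \<and> x0 \<in> N \<and> N \<subseteq> \<Omega> \<and> C_closure 2 \<phi> N \<and>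
        \<phi> x0 = u x0 \<and> (\<forall>x\<in>N - {x0}. \<phi> x < u x) \<longrightarrow>
        I_op \<L> (\<lambda>x. if x \<in> N then \<phi> x else u x) x0 \<le> f x0)"

definition visc_eq :: "(('a::euclidean_space \<Rightarrow> real) \<Rightarrow> 'a \<Rightarrow> real) set \<Rightarrow> 'a set \<Rightarrow>
    ('a \<Rightarrow> real) \<Rightarrow> ('a \<Rightarrow> real) \<Rightarrow> bool" where
  "visc_eq \<L> \<Omega> u f \<longleftrightarrow> visc_ge \<L> \<Omega> u f \<and> visc_le \<L> \<Omega> u f"


section \<open>Principal eigenvalues and eigenfunctions\<close>

definition Lambda_plus ::
  "real \<Rightarrow> (('a::euclidean_space \<Rightarrow> real) \<Rightarrow> 'a \<Rightarrow> real) set \<Rightarrow> 'a set \<Rightarrow> real" where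
  "Lambda_plus s \<L> \<Omega> = Sup {\<mu>. \<exists>\<psi>. continuous_on UNIV \<psi> \<and> \<psi> \<in> L1_omega s \<and>
     (\<forall>x. \<psi> x \<ge> 0) \<and> (\<forall>x\<in>\<Omega>. \<psi> x > 0) \<and> visc_le \<L> \<Omega> \<psi> (\<lambda>x. - \<mu> * \<psi> x)}"

definition Lambda_minus ::
  "real \<Rightarrow> (('a::euclidean_space \<Rightarrow> real) \<Rightarrow> 'a \<Rightarrow> real) set \<Rightarrow> 'a set \<Rightarrow> real" where
  "Lambda_minus s \<L> \<Omega> = Sup {\<mu>. \<exists>\<psi>. continuous_on UNIV \<psi> \<and> \<psi> \<in> L1_omega s \<and>
     (\<forall>x. \<psi> x \<le> 0) \<and> (\<forall>x\<in>\<Omega>. \<psi> x < 0) \<and> visc_ge \<L> \<Omega> \<psi> (\<lambda>x. - \<mu> * \<psi> x)}"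

definition eigenfunction_plus ::
  "real \<Rightarrow> (('a::euclidean_space \<Rightarrow> real) \<Rightarrow> 'a \<Rightarrow> real) set \<Rightarrow> 'a set \<Rightarrow> ('a \<Rightarrow> real) \<Rightarrow> bool" where
  "eigenfunction_plus s \<L> \<Omega> \<Psi> \<longleftrightarrow>
     \<Psi> \<in> C_2s_plus s \<Omega> \<inter> C_zero \<Omega> \<and>
     visc_eq \<L> \<Omega> \<Psi> (\<lambda>x. - Lambda_plus s \<L> \<Omega> * \<Psi> x) \<and> (\<forall>x\<in>\<Omega>. \<Psi> x > 0)"

definition eigenfunction_minus ::
  "real \<Rightarrow> (('a::euclidean_space \<Rightarrow> real) \<Rightarrow> 'a \<Rightarrow> real) set \<Rightarrow> 'a set \<Rightarrow> ('a \<Rightarrow> real) \<Rightarrow> bool" where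
  "eigenfunction_minus s \<L> \<Omega> \<Psi> \<longleftrightarrow>
     \<Psi> \<in> C_2s_plus s \<Omega> \<inter> C_zero \<Omega> \<and>
     visc_eq \<L> \<Omega> \<Psi> (\<lambda>x. - Lambda_minus s \<L> \<Omega> * \<Psi> x) \<and> (\<forall>x\<in>\<Omega>. \<Psi> x < 0)"

end

theory Submission
  imports Defs
begin

text \<open>
  Write \<open>\<mu>\<close> for the eigenvalue and \<open>\<Psi> > 0\<close> for the eigenfunction, and let \<open>u\<close> be a subsolution with
  \<open>u \<le> 0\<close> outside \<open>\<Omega>\<close> and \<open>u > 0\<close> somewhere.  Slide \<open>t \<Psi>\<close> down from above until it touches \<open>u\<close>: with
  \<open>T\<close> the least \<open>t > 0\<close> for which \<open>u \<le> t \<Psi>\<close>, the difference \<open>u - T \<Psi>\<close> is nonpositive and, by convexity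
  of \<open>I\<close>, a subsolution of the same equation.  The aim is that it vanishes identically.

  Everything about differences of a subsolution and a supersolution is extracted from one inequality,
  \<open>max_point_inequality\<close>: at a global maximum point \<open>x1 \<in> \<Omega>\<close> of \<open>w = u - v\<close>, the integral of the second
  differences of \<open>w\<close> against \<open>lam * |z| powr (- d - 2 s)\<close> over any annulus is at least twice the difference
  of the two right-hand sides.  It is proved by doubling of variables, which works directly with viscosity
  inequalities for merely continuous functions: paraboloids touch both functions near the doubled maximum,
  their contribution disappears with the radius of the balls on which they are used, and, the
  operators being translation invariant, the rest is a pointwise inequality between second differences.

  Two consequences finish the argument (\<open>proportional_of_max_inequality\<close>).  Choose a compact \<open>K \<subseteq> \<Omega>\<close> with
  \<open>\<Omega> - K\<close> of small measure.  If \<open>w = u - t \<Psi> \<le> 0\<close> on \<open>K\<close> had a positive maximum \<open>M\<close>, it would be attained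
  in \<open>\<Omega> - K\<close>; there \<open>w\<close> drops by \<open>M\<close> at once on leaving the small set \<open>\<Omega> - K\<close>, so that the integral lies
  below \<open>- C M\<close> with \<open>C\<close> as large as desired (\<open>annulus_mass_large\<close>), and this contradicts the lower bound
  \<open>- 2 \<mu> M\<close>.  Hence \<open>u < T \<Psi>\<close> on all of \<open>K\<close> would allow a smaller \<open>T\<close>, and \<open>u\<close> and \<open>T \<Psi>\<close> touch at a point
  of \<open>K\<close>.  At this point \<open>w\<close> has the maximum \<open>0\<close>, so the integrals over all annuli are \<open>\<ge> 0\<close> while their
  integrands are \<open>\<le> 0\<close>; thus \<open>w = 0\<close> everywhere, outside \<open>\<Omega>\<close> as well (\<open>vanishes_of_touching_zero\<close>).

  For \<open>\<Psi> < 0\<close> and a supersolution \<open>u\<close> the same reasoning applies to \<open>T \<Psi> - u\<close>.  The signs that are left over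
  for solutions of the equation are treated with the fact that the negative of a supersolution is a
  subsolution (\<open>paraboloid_sub_uminus\<close>): a solution \<open>u \<le> 0\<close> with eigenvalue \<open>\<Lambda>\<^sup>+\<close> gives the positive
  subsolution \<open>- u\<close>, to be compared with \<open>\<Psi>\<^sup>+\<close>; a nonzero solution \<open>u \<ge> 0\<close> with eigenvalue \<open>\<Lambda>\<^sup>-\<close> is positive in \<open>\<Omega>\<close>
  (\<open>strong_minimum_principle\<close>) and takes the role of \<open>\<Psi>\<close> in the comparison with the subsolution \<open>- \<Psi>\<^sup>-\<close>.
\<close>

section \<open>The Riesz kernel\<close>

definition riesz :: "real \<Rightarrow> 'a::euclidean_space \<Rightarrow> real" where
  "riesz s z = 1 / norm z powr (real DIM('a) + 2 * s)"

definition second_diff :: "('a::euclidean_space \<Rightarrow> real) \<Rightarrow> 'a \<Rightarrow> 'a \<Rightarrow> real" where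
  "second_diff u x z = u (x + z) + u (x - z) - 2 * u x"

lemma riesz_nonneg: "riesz s z \<ge> 0"
  by (simp add: riesz_def)

lemma riesz_pos: "z \<noteq> 0 \<Longrightarrow> riesz s z > 0"
  by (simp add: riesz_def)

lemma riesz_measurable [measurable]: "riesz s \<in> borel_measurable borel"
  unfolding riesz_def by measurable

lemma borel_imp_lebesgue_measurable:
  fixes f :: "'a::euclidean_space \<Rightarrow> real"
  shows "f \<in> borel_measurable borel \<Longrightarrow> f \<in> borel_measurable lebesgue"
  by (simp add: measurable_completion)

lemma integrable_lebesgue_iff_lborel:
  fixes f :: "'a::euclidean_space \<Rightarrow> real"
  shows "f \<in> borel_measurable borel \<Longrightarrow> integrable lebesgue f \<longleftrightarrow> integrable lborel f"
  by (rule integrable_completion) simp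

text \<open>Integrability on the whole space is tested on a countable cover by balls: \<open>f\<close> is dominated by a
  series of multiples of indicators of balls, whose integral is a numerical series.\<close>

lemma integrable_of_dyadic_bound:
  fixes f :: "'a::euclidean_space \<Rightarrow> real" and a \<rho> :: "nat \<Rightarrow> real"
  assumes [measurable]: "f \<in> borel_measurable borel" and nn: "\<And>z. 0 \<le> f z"
    and a: "\<And>k. 0 \<le> a k" and \<rho>: "\<And>k. 0 \<le> \<rho> k"
    and sm: "summable (\<lambda>k. a k * \<rho> k ^ DIM('a))"
    and bound: "\<And>z. f z \<noteq> 0 \<Longrightarrow> \<exists>k. norm z < \<rho> k \<and> f z \<le> a k"
  shows "integrable lebesgue f"
proof -
  let ?V = "unit_ball_vol (real DIM('a))"
  have le: "ennreal (f z) \<le> (\<Sum>k. ennreal (a k) * indicator (ball 0 (\<rho> k)) z)" for z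
  proof (cases "f z = 0")
    case False
    then obtain k where k: "norm z < \<rho> k" "f z \<le> a k" using bound by blast
    define g where "g = (\<lambda>k. ennreal (a k) * indicator (ball 0 (\<rho> k)) z)"
    have "ennreal (f z) \<le> g k"
      using k nn by (auto simp: g_def indicator_def ennreal_leI)
    also have "g k \<le> (\<Sum>k. g k)"
      using sum_le_suminf[OF summableI, of "{k}" g] by simp
    also have "\<dots> = (\<Sum>k. ennreal (a k) * indicator (ball 0 (\<rho> k)) z)"
      by (simp add: g_def)
    finally show ?thesis .
  qed auto
  have "(\<integral>\<^sup>+z. ennreal (f z) \<partial>lborel)
      \<le> (\<integral>\<^sup>+z. (\<Sum>k. ennreal (a k) * indicator (ball 0 (\<rho> k)) z) \<partial>(lborel::'a measure))"
    by (intro nn_integral_mono) (use le in auto)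
  also have "\<dots> = (\<Sum>k. ennreal (a k) * emeasure (lborel::'a measure) (ball 0 (\<rho> k)))"
    by (subst nn_integral_suminf)
      (auto simp: nn_integral_cmult_indicator simp del: mult_indicator_cong
        intro!: borel_measurable_times_ennreal borel_measurable_indicator)
  also have "\<dots> = (\<Sum>k. ennreal (?V * (a k * \<rho> k ^ DIM('a))))"
    using a \<rho> by (intro suminf_cong) (simp add: emeasure_ball ennreal_mult'[symmetric] mult_ac)
  also have "\<dots> < \<infinity>"
  proof -
    have "summable (\<lambda>k. ?V * (a k * \<rho> k ^ DIM('a)))"
      using sm by (rule summable_mult)
    moreover have "\<And>k. 0 \<le> ?V * (a k * \<rho> k ^ DIM('a))"
      using a \<rho> by simp
    ultimately show ?thesis
      by (simp add: suminf_ennreal2)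
  qed
  finally have "integrable lborel f"
    using nn by (intro integrableI_nonneg) auto
  then show ?thesis by (simp add: integrable_lebesgue_iff_lborel)
qed

lemma dyadic_scale:
  fixes t :: real
  assumes "t \<ge> 1"
  obtains k :: nat where "2 ^ k \<le> t" "t < 2 ^ Suc k"
proof -
  obtain n where n: "t < 2 ^ n" using real_arch_pow[of 2 t] by auto
  define m where "m = (LEAST n. t < 2 ^ n)"
  have m: "t < 2 ^ m" unfolding m_def by (rule LeastI, rule n)
  have "m \<noteq> 0" using m assms by (intro notI) simp
  then obtain k where k: "m = Suc k" by (cases m) auto
  have "\<not> t < 2 ^ k"
    using not_less_Least[of k "\<lambda>n. t < 2 ^ n"] k unfolding m_def by simp
  then show ?thesis using that[of k] m k by auto
qed

text \<open>On the dyadic shell of radius \<open>\<sigma>\<close> the integrand is of size \<open>\<sigma> powr (2 - d - 2 s)\<close> near the origin and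
  \<open>\<sigma> powr (- d - 2 s)\<close> far from it, so that its integral over the shell is of size \<open>\<sigma> powr (2 - 2 s)\<close> and
  \<open>\<sigma> powr (- 2 s)\<close>, respectively; both geometric series converge for \<open>0 < s < 1\<close>.\<close>

lemma min_riesz_integrable:
  fixes s :: real
  assumes s: "0 < s" "s < 1"
  shows "integrable lebesgue (\<lambda>z::'a::euclidean_space. min 1 ((norm z)\<^sup>2) * riesz s z)"
proof -
  let ?D = "DIM('a)" and ?p = "real DIM('a) + 2 * s"
  define f where "f = (\<lambda>z::'a. if norm z < 1 then (norm z)\<^sup>2 * riesz s z else 0)"
  define g where "g = (\<lambda>z::'a. if norm z < 1 then 0 else riesz s z)"
  have "integrable lebesgue f"
  proof (rule integrable_of_dyadic_bound[where
        a = "\<lambda>k. (1/4) ^ k * (2 ^ Suc k) powr ?p" and \<rho> = "\<lambda>k. 2 * (1/2) ^ k"])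
    show "f \<in> borel_measurable borel" unfolding f_def by measurable
    show "0 \<le> f z" for z by (simp add: f_def riesz_nonneg)
    show "summable (\<lambda>k. (1/4) ^ k * (2 ^ Suc k) powr ?p * (2 * (1/2) ^ k) ^ ?D)"
    proof -
      have eq: "(1/4) ^ k * (2 ^ Suc k) powr ?p * (2 * (1/2) ^ k) ^ ?D
          = 2 powr (2 * ?D + 2 * s) * (2 powr (2 * s - 2)) ^ k" for k
      proof -
        have 1: "(1/4::real) ^ k = 2 powr (- 2 * k)"
          by (simp add: powr_minus powr_realpow[symmetric] power_divide powr_powr[symmetric] inverse_eq_divide)
        have 2: "(2 ^ Suc k) powr ?p = 2 powr (Suc k * ?p)"
          by (metis powr_powr powr_realpow zero_less_numeral)
        have 3: "(2 * (1/2::real) ^ k) ^ ?D = 2 powr ((1 - real k) * ?D)"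
        proof -
          have "2 * (1/2::real) ^ k = 2 powr (1 - real k)"
            by (simp add: powr_diff powr_realpow power_divide)
          then show ?thesis by (metis powr_gt_zero powr_powr powr_realpow zero_neq_numeral)
        qed
        have 4: "(2 powr (2 * s - 2)) ^ k = 2 powr ((2 * s - 2) * real k)"
          by (metis powr_gt_zero powr_powr powr_realpow zero_neq_numeral)
        show ?thesis unfolding 1 2 3 4 powr_add[symmetric]
          by (rule arg_cong[where f="\<lambda>x. 2 powr x"]) (simp add: algebra_simps)
      qed
      have "norm (2 powr (2 * s - 2) :: real) < 1"
        using s by (simp add: powr_less_one)
      then show ?thesis unfolding eq by (intro summable_mult summable_geometric)
    qed
    fix z assume "f z \<noteq> 0"
    then have z: "z \<noteq> 0" "norm z < 1" by (auto simp: f_def split: if_splits)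
    then have "1 / norm z \<ge> 1" by simp
    then obtain k where k: "2 ^ k \<le> 1 / norm z" "1 / norm z < 2 ^ Suc k"
      by (rule dyadic_scale)
    have le: "norm z \<le> (1/2) ^ k"
      using k(1) z by (simp add: field_simps power_divide)
    have "(norm z)\<^sup>2 \<le> (1/4) ^ k"
    proof -
      have "(norm z)\<^sup>2 \<le> ((1/2) ^ k)\<^sup>2" using le by (intro power_mono) auto
      also have "\<dots> = (1/4) ^ k" by (simp add: power2_eq_square power_mult_distrib[symmetric])
      finally show ?thesis .
    qed
    moreover have "riesz s z \<le> (2 ^ Suc k) powr ?p"
    proof -
      have "riesz s z = (1 / norm z) powr ?p"
        using z by (simp add: riesz_def powr_divide)
      also have "\<dots> \<le> (2 ^ Suc k) powr ?p"
        using k(2) s by (intro powr_mono2) auto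
      finally show ?thesis .
    qed
    ultimately have "f z \<le> (1/4) ^ k * (2 ^ Suc k) powr ?p"
      using z by (simp add: f_def riesz_nonneg mult_mono)
    moreover have "norm z < 2 * (1/2) ^ k" using le by (smt (verit) zero_less_power divide_pos_pos)
    ultimately show "\<exists>k. norm z < 2 * (1/2) ^ k \<and> f z \<le> (1/4) ^ k * (2 ^ Suc k) powr ?p"
      by blast
  qed auto
  moreover have "integrable lebesgue g"
  proof (rule integrable_of_dyadic_bound[where
        a = "\<lambda>k. ((1/2) ^ k) powr ?p" and \<rho> = "\<lambda>k. 2 ^ Suc k"])
    show "g \<in> borel_measurable borel" unfolding g_def by measurable
    show "0 \<le> g z" for z by (simp add: g_def riesz_nonneg)
    show "summable (\<lambda>k. ((1/2) ^ k) powr ?p * (2 ^ Suc k) ^ ?D)"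
    proof -
      have eq: "((1/2) ^ k) powr ?p * (2 ^ Suc k) ^ ?D = 2 ^ ?D * (2 powr (- 2 * s)) ^ k" for k
      proof -
        have 1: "((1/2::real) ^ k) powr ?p = 2 powr (- real k * ?p)"
        proof -
          have "(1/2::real) ^ k = 2 powr (- real k)"
            by (simp add: powr_minus powr_realpow power_divide inverse_eq_divide)
          then show ?thesis by (simp add: powr_powr)
        qed
        have 2: "(2 ^ Suc k :: real) ^ ?D = 2 powr (real (Suc k) * ?D)"
          by (metis of_nat_mult power_mult powr_realpow zero_less_numeral)
        have 3: "(2 powr (- 2 * s)) ^ k = 2 powr ((- 2 * s) * real k)"
          by (metis powr_gt_zero powr_powr powr_realpow zero_neq_numeral)
        have 4: "(2::real) ^ ?D = 2 powr real ?D" by (simp add: powr_realpow)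
        show ?thesis unfolding 1 2 3 4 powr_add[symmetric]
          by (rule arg_cong[where f="\<lambda>x. 2 powr x"]) (simp add: algebra_simps)
      qed
      have "norm (2 powr (- 2 * s) :: real) < 1"
        using s by (simp add: powr_less_one)
      then show ?thesis unfolding eq by (intro summable_mult summable_geometric)
    qed
    fix z assume "g z \<noteq> 0"
    then have z: "norm z \<ge> 1" by (auto simp: g_def split: if_splits)
    then obtain k where k: "2 ^ k \<le> norm z" "norm z < 2 ^ Suc k"
      by (rule dyadic_scale)
    have "g z = (1 / norm z) powr ?p"
      using z by (simp add: g_def riesz_def powr_divide)
    also have "\<dots> \<le> ((1/2) ^ k) powr ?p"
    proof (rule powr_mono2)
      have "1 / norm z \<le> 1 / 2 ^ k" using k(1) by (intro frac_le) auto
      then show "1 / norm z \<le> (1/2) ^ k" by (simp add: power_one_over)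
    qed (use s in auto)
    finally show "\<exists>k. norm z < 2 ^ Suc k \<and> g z \<le> ((1/2) ^ k) powr ?p"
      using k by blast
  qed auto
  ultimately have "integrable lebesgue (\<lambda>z. f z + g z)" by simp
  also have "(\<lambda>z. f z + g z) = (\<lambda>z. min 1 ((norm z)\<^sup>2) * riesz s z)"
  proof
    fix z :: 'a
    have "norm z < 1 \<Longrightarrow> (norm z)\<^sup>2 \<le> 1" by (simp add: power_le_one)
    moreover have "\<not> norm z < 1 \<Longrightarrow> (norm z)\<^sup>2 \<ge> 1" by simp
    ultimately show "f z + g z = min 1 ((norm z)\<^sup>2) * riesz s z"
      by (auto simp: f_def g_def min_def)
  qed
  finally show ?thesis .
qed

lemma integrable_lebesgue_affine:
  fixes f :: "'a::euclidean_space \<Rightarrow> real"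
  assumes [measurable]: "f \<in> borel_measurable borel" and f: "integrable lebesgue f" and c: "c = 1 \<or> c = -1"
  shows "integrable lebesgue (\<lambda>z. f (x + c *\<^sub>R z))"
proof -
  have "integrable lborel f" using f by (simp add: integrable_lebesgue_iff_lborel)
  moreover have "distr lborel borel (\<lambda>z. x + c *\<^sub>R z) = (lborel :: 'a measure)"
    using lborel_affine[of c x] c by (auto simp: density_1)
  ultimately have "integrable (distr lborel borel (\<lambda>z. x + c *\<^sub>R z)) f" by simp
  then have "integrable lborel (\<lambda>z. f (x + c *\<^sub>R z))"
    by (subst (asm) integrable_distr_eq) auto
  then show ?thesis by (subst integrable_lebesgue_iff_lborel) auto
qed

text \<open>Away from the origin, \<open>1 + |x + c z| \<le> (1 + |x|) (1 + 1 / \<delta>) |z|\<close>, which compares the kernel with the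
  translated (for \<open>c = - 1\<close>, also reflected) weight of \<open>L1_omega\<close>.\<close>

lemma tail_integrable:
  fixes u :: "'a::euclidean_space \<Rightarrow> real"
  assumes s: "0 < s" and u: "continuous_on UNIV u" "u \<in> L1_omega s" and d: "0 < \<delta>"
    and c: "c = 1 \<or> c = -1"
  shows "integrable lebesgue (\<lambda>z. indicator {z. \<delta> \<le> norm z} z * u (x + c *\<^sub>R z) * riesz s z)"
proof -
  let ?p = "real DIM('a) + 2 * s"
  define h where "h = (\<lambda>y. u y * (1 + norm y) powr (- ?p))"
  have [measurable]: "u \<in> borel_measurable borel"
    using u(1) by (rule borel_measurable_continuous_onI)
  have hm [measurable]: "h \<in> borel_measurable borel" unfolding h_def by measurable
  have "integrable lebesgue h" using u(2) by (simp add: L1_omega_def h_def)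
  then have hi: "integrable lebesgue (\<lambda>z. h (x + c *\<^sub>R z))"
    using c by (intro integrable_lebesgue_affine) auto
  define C where "C = (1 + norm x) * (1 + 1 / \<delta>)"
  have C: "C > 0" using d by (simp add: C_def add_pos_nonneg)
  have bnd: "riesz s z \<le> C powr ?p * (1 + norm (x + c *\<^sub>R z)) powr (- ?p)" if z: "\<delta> \<le> norm z" for z
  proof -
    have z0: "norm z > 0" using z d by linarith
    have "1 + norm (x + c *\<^sub>R z) \<le> 1 + norm x + norm z"
      using norm_triangle_ineq[of x "c *\<^sub>R z"] c by auto
    also have "\<dots> \<le> (1 + norm x) * (1 + norm z)" by (simp add: algebra_simps)
    also have "\<dots> \<le> (1 + norm x) * ((1 + 1 / \<delta>) * norm z)"
      using z d by (intro mult_left_mono) (auto simp: field_simps)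
    finally have le: "1 + norm (x + c *\<^sub>R z) \<le> C * norm z" by (simp add: C_def)
    have pos: "0 < 1 + norm (x + c *\<^sub>R z)" by (simp add: add_pos_nonneg)
    have "(1 + norm (x + c *\<^sub>R z)) powr ?p \<le> (C * norm z) powr ?p"
      using le pos s by (intro powr_mono2) auto
    also have "\<dots> = C powr ?p * norm z powr ?p"
      using C by (simp add: powr_mult)
    finally have *: "(1 + norm (x + c *\<^sub>R z)) powr ?p \<le> C powr ?p * norm z powr ?p" .
    have "(1 + norm (x + c *\<^sub>R z)) powr ?p > 0" "norm z powr ?p > 0" using pos z0 by simp_all
    then show ?thesis using * unfolding riesz_def powr_minus by (simp add: field_simps)
  qed
  show ?thesis
  proof (rule Bochner_Integration.integrable_bound)
    show "integrable lebesgue (\<lambda>z. C powr ?p * h (x + c *\<^sub>R z))" using hi by simp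
    show "(\<lambda>z. indicator {z. \<delta> \<le> norm z} z * u (x + c *\<^sub>R z) * riesz s z) \<in> borel_measurable lebesgue"
      by (rule borel_imp_lebesgue_measurable) measurable
    show "AE z in lebesgue. norm (indicator {z. \<delta> \<le> norm z} z * u (x + c *\<^sub>R z) * riesz s z)
        \<le> norm (C powr ?p * h (x + c *\<^sub>R z))"
    proof (rule AE_I2)
      fix z :: 'a
      have "\<bar>u (x + c *\<^sub>R z)\<bar> * riesz s z
          \<le> \<bar>u (x + c *\<^sub>R z)\<bar> * (C powr ?p * (1 + norm (x + c *\<^sub>R z)) powr (- ?p))"
        if "\<delta> \<le> norm z" using bnd[OF that] by (intro mult_left_mono) auto
      then show "norm (indicator {z. \<delta> \<le> norm z} z * u (x + c *\<^sub>R z) * riesz s z)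
          \<le> norm (C powr ?p * h (x + c *\<^sub>R z))"
        using C by (auto simp: h_def abs_mult riesz_nonneg indicator_def mult_ac)
    qed
  qed
qed

lemma riesz_integrable_of_bound:
  fixes h :: "'a::euclidean_space \<Rightarrow> real"
  assumes s: "0 < s" "s < 1" and h[measurable]: "h \<in> borel_measurable borel"
    and b: "\<And>z. \<bar>h z\<bar> \<le> C * min 1 ((norm z)\<^sup>2)"
  shows "integrable lebesgue (\<lambda>z. h z * riesz s z)"
proof (rule Bochner_Integration.integrable_bound)
  show "integrable lebesgue (\<lambda>z::'a. C * (min 1 ((norm z)\<^sup>2) * riesz s z))"
    by (intro integrable_mult_right min_riesz_integrable s)
  show "(\<lambda>z. h z * riesz s z) \<in> borel_measurable lebesgue"
    by (rule borel_imp_lebesgue_measurable) measurable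
  have "\<bar>h z\<bar> * riesz s z \<le> (C * min 1 ((norm z)\<^sup>2)) * riesz s z" for z
    using b riesz_nonneg by (rule mult_right_mono)
  then have "\<bar>h z * riesz s z\<bar> \<le> \<bar>C * (min 1 ((norm z)\<^sup>2) * riesz s z)\<bar>" for z
    by (intro order_trans[OF _ abs_ge_self]) (simp add: abs_mult riesz_nonneg mult_ac)
  then show "AE z in lebesgue. norm (h z * riesz s z) \<le> norm (C * (min 1 ((norm z)\<^sup>2) * riesz s z))"
    by simp
qed

lemma inside_bound:
  fixes z :: "'a::euclidean_space"
  assumes "norm z < \<delta>"
  shows "(norm z)\<^sup>2 \<le> (1 + \<delta>\<^sup>2) * min 1 ((norm z)\<^sup>2)"
proof -
  have "(norm z)\<^sup>2 \<le> \<delta>\<^sup>2" using assms by (intro power_mono) auto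
  moreover have "0 \<le> \<delta>\<^sup>2 * (norm z)\<^sup>2" by simp
  ultimately show ?thesis by (auto simp: min_def algebra_simps)
qed

lemma outside_bound:
  fixes z :: "'a::euclidean_space"
  assumes "0 < \<delta>" "\<delta> \<le> norm z"
  shows "1 \<le> (1 + 1 / \<delta>\<^sup>2) * min 1 ((norm z)\<^sup>2)"
proof -
  have "\<delta>\<^sup>2 \<le> (norm z)\<^sup>2" using assms by (intro power_mono) auto
  then have "1 \<le> 1 / \<delta>\<^sup>2 * (norm z)\<^sup>2" using assms by (simp add: field_simps)
  moreover have "0 \<le> (norm z)\<^sup>2" "0 \<le> 1 / \<delta>\<^sup>2" by simp_all
  ultimately show ?thesis by (simp add: min_def distrib_right add_increasing)
qed

abbreviation annulus :: "real \<Rightarrow> real \<Rightarrow> 'a::euclidean_space set" where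
  "annulus r R \<equiv> {z. r \<le> norm z \<and> norm z \<le> R}"

text \<open>Up to a positive factor, the singular integral of the fractional Laplacian, cut off to an annulus
  on which its kernel is bounded if \<open>r > 0\<close>; then it converges for every continuous \<open>w\<close>.\<close>
abbreviation truncated_laplacian ::
    "real \<Rightarrow> real \<Rightarrow> real \<Rightarrow> ('a::euclidean_space \<Rightarrow> real) \<Rightarrow> 'a \<Rightarrow> real" where
  "truncated_laplacian s r R w x \<equiv>
     (LINT z|lebesgue. indicator (annulus r R) z * second_diff w x z * riesz s z)"

lemma second_diff_measurable:
  "continuous_on UNIV u \<Longrightarrow> second_diff u x \<in> borel_measurable borel"
proof -
  assume "continuous_on UNIV u"
  then have [measurable]: "u \<in> borel_measurable borel" by (rule borel_measurable_continuous_onI)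
  show ?thesis unfolding second_diff_def by measurable
qed

lemma annulus_mass_integrable:
  assumes s: "0 < s" "s < 1" and r: "0 < r"
  shows "integrable lebesgue (\<lambda>z::'a::euclidean_space.
           indicator (annulus r R) z * riesz s z)"
proof (rule riesz_integrable_of_bound[OF s])
  show "indicator (annulus r R :: 'a set) \<in> borel_measurable borel" by measurable
  show "\<bar>indicator (annulus r R) z\<bar> \<le> (1 + 1 / r\<^sup>2) * min 1 ((norm z)\<^sup>2)" for z
    using outside_bound[OF r, of z] by (auto simp: indicator_def)
qed

lemma second_diff_bounded:
  fixes u :: "'a::euclidean_space \<Rightarrow> real"
  assumes u: "continuous_on UNIV u"
  obtains B where "\<And>x z. dist x1 x \<le> d \<Longrightarrow> norm z \<le> R \<Longrightarrow> \<bar>second_diff u x z\<bar> \<le> B"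
proof -
  have "compact (u ` cball x1 (d + \<bar>R\<bar>))"
    using u by (intro compact_continuous_image) (auto intro: continuous_on_subset)
  then obtain B where B: "\<And>x. x \<in> cball x1 (d + \<bar>R\<bar>) \<Longrightarrow> \<bar>u x\<bar> \<le> B"
    using compact_imp_bounded[THEN bounded_iff[THEN iffD1]] by (metis imageI real_norm_def)
  show ?thesis
  proof (rule that[of "4 * B"])
    fix x z :: 'a assume x: "dist x1 x \<le> d" and z: "norm z \<le> R"
    have m: "x + z \<in> cball x1 (d + \<bar>R\<bar>)" "x - z \<in> cball x1 (d + \<bar>R\<bar>)" "x \<in> cball x1 (d + \<bar>R\<bar>)"
      using x z dist_triangle[of x1 "x + z" x] dist_triangle[of x1 "x - z" x]
      by (auto simp: dist_norm)
    show "\<bar>second_diff u x z\<bar> \<le> 4 * B"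
      using B[OF m(1)] B[OF m(2)] B[OF m(3)] unfolding second_diff_def by linarith
  qed
qed

lemma second_diff_annulus_integrable:
  fixes w :: "'a::euclidean_space \<Rightarrow> real"
  assumes s: "0 < s" "s < 1" and w: "continuous_on UNIV w" and r: "0 < r"
  shows "integrable lebesgue (\<lambda>z. indicator (annulus r R) z * second_diff w x z * riesz s z)"
proof -
  let ?A = "(annulus r R :: 'a set)"
  obtain B where B: "\<And>y z. dist x y \<le> 0 \<Longrightarrow> norm z \<le> R \<Longrightarrow> \<bar>second_diff w y z\<bar> \<le> B"
    using second_diff_bounded[OF w, where d = 0] by blast
  have [measurable]: "second_diff w x \<in> borel_measurable borel"
    by (rule second_diff_measurable[OF w])
  show ?thesis
  proof (rule Bochner_Integration.integrable_bound)
    show "integrable lebesgue (\<lambda>z. B * (indicator ?A z * riesz s z))"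
      by (intro integrable_mult_right annulus_mass_integrable s r)
    show "(\<lambda>z. indicator ?A z * second_diff w x z * riesz s z) \<in> borel_measurable lebesgue"
      by (rule borel_imp_lebesgue_measurable) measurable
    show "AE z in lebesgue. norm (indicator ?A z * second_diff w x z * riesz s z)
        \<le> norm (B * (indicator ?A z * riesz s z))"
    proof (rule AE_I2)
      fix z
      have "\<bar>second_diff w x z\<bar> * riesz s z \<le> \<bar>B\<bar> * riesz s z" if "norm z \<le> R"
        using B[of x z] that by (intro mult_right_mono riesz_nonneg) auto
      then show "norm (indicator ?A z * second_diff w x z * riesz s z) \<le> norm (B * (indicator ?A z * riesz s z))"
        by (simp add: indicator_def abs_mult riesz_nonneg)
    qed
  qed
qed

lemma truncated_laplacian_tendsto:
  fixes u :: "'a::euclidean_space \<Rightarrow> real"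
  assumes s: "0 < s" "s < 1" and u: "continuous_on UNIV u" and r: "0 < r"
    and X: "X \<longlonglongrightarrow> x1" "\<And>n::nat. dist x1 (X n) \<le> d"
  shows "(\<lambda>n. truncated_laplacian s r R u (X n))
    \<longlonglongrightarrow> truncated_laplacian s r R u x1"
proof -
  let ?A = "(annulus r R :: 'a set)"
  obtain B where B: "\<And>x z. dist x1 x \<le> d \<Longrightarrow> norm z \<le> R \<Longrightarrow> \<bar>second_diff u x z\<bar> \<le> B"
    using second_diff_bounded[OF u] by blast
  have lim: "(\<lambda>n. second_diff u (X n) z) \<longlonglongrightarrow> second_diff u x1 z" for z
  proof -
    have c: "\<And>x. isCont u x" using u by (simp add: continuous_on_eq_continuous_at)
    have t: "(\<lambda>n. u (X n + z)) \<longlonglongrightarrow> u (x1 + z)" "(\<lambda>n. u (X n - z)) \<longlonglongrightarrow> u (x1 - z)"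
        "(\<lambda>n. u (X n)) \<longlonglongrightarrow> u x1"
      by (rule isCont_tendsto_compose[OF c], intro tendsto_intros X(1))+
    show ?thesis unfolding second_diff_def by (intro tendsto_intros t)
  qed
  have [measurable]: "second_diff u x \<in> borel_measurable borel" for x
    by (rule second_diff_measurable[OF u])
  show ?thesis
  proof (rule integral_dominated_convergence[where w = "\<lambda>z. B * (indicator ?A z * riesz s z)"])
    show "(\<lambda>z. indicator ?A z * second_diff u x1 z * riesz s z) \<in> borel_measurable lebesgue"
      by (rule borel_imp_lebesgue_measurable) measurable
    show "(\<lambda>z. indicator ?A z * second_diff u (X n) z * riesz s z) \<in> borel_measurable lebesgue" for n
      by (rule borel_imp_lebesgue_measurable) measurable
    show "integrable lebesgue (\<lambda>z. B * (indicator ?A z * riesz s z))"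
      by (intro integrable_mult_right annulus_mass_integrable s r)
    show "AE z in lebesgue. (\<lambda>n. indicator ?A z * second_diff u (X n) z * riesz s z)
        \<longlonglongrightarrow> indicator ?A z * second_diff u x1 z * riesz s z"
      by (intro AE_I2 tendsto_mult tendsto_const lim)
    show "AE z in lebesgue. norm (indicator ?A z * second_diff u (X n) z * riesz s z)
        \<le> B * (indicator ?A z * riesz s z)" for n
    proof (rule AE_I2)
      fix z
      have "\<bar>second_diff u (X n) z\<bar> * riesz s z \<le> B * riesz s z" if "norm z \<le> R"
        using B[OF X(2) that] riesz_nonneg by (rule mult_right_mono)
      then show "norm (indicator ?A z * second_diff u (X n) z * riesz s z) \<le> B * (indicator ?A z * riesz s z)"
        by (simp add: indicator_def abs_mult riesz_nonneg)
    qed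
  qed
qed

text \<open>On a ball of radius \<open>\<rho>\<close> the kernel is at least \<open>\<rho> powr (- d - 2 s)\<close>, while the ball has volume
  \<open>V * \<rho> ^ d\<close>.  After removal of a concentric ball and of a set \<open>E\<close>, each with at most a quarter of this
  volume, the integral is still at least \<open>V / 2 * \<rho> powr (- 2 s)\<close>, which is large for small \<open>\<rho>\<close>.  This is what
  makes the maximum principle hold in sets of small measure.\<close>

lemma annulus_mass_large:
  fixes s m :: real
  assumes s: "0 < s" "s < 1"
  shows "\<exists>\<epsilon>>0. \<exists>r R. 0 < r \<and> (\<forall>E::'a::euclidean_space set. E \<in> lmeasurable \<longrightarrow> measure lebesgue E \<le> \<epsilon> \<longrightarrow>
     m < (LINT z|lebesgue. indicator (annulus r R - E) z * riesz s z))"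
proof -
  let ?D = "DIM('a)" and ?p = "real DIM('a) + 2 * s"
  define V where "V = unit_ball_vol (real ?D)"
  have V: "V > 0" by (simp add: V_def)
  \<comment> \<open>\<open>\<rho>\<close> solves \<open>\<rho> powr (- 2 s) = b\<close>, and \<open>b\<close> is chosen so that \<open>V / 2 * b > m\<close>.\<close>
  define b where "b = 2 * \<bar>m\<bar> / V + 1"
  have b: "0 < b" using V by (simp add: b_def add_nonneg_pos)
  define \<rho> where "\<rho> = b powr (- (1 / (2 * s)))"
  have \<rho>: "0 < \<rho>" "m < V / 2 * \<rho> powr (- (2 * s))"
  proof -
    show "0 < \<rho>" using b by (simp add: \<rho>_def)
    have "\<rho> powr (- (2 * s)) = b" using s b by (simp add: \<rho>_def powr_powr)
    moreover have "V / 2 * b = \<bar>m\<bar> + V / 2" using V by (simp add: b_def field_simps)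
    ultimately show "m < V / 2 * \<rho> powr (- (2 * s))" using V by simp
  qed
  define \<epsilon> where "\<epsilon> = V * \<rho> ^ ?D / 4"
  define A where "A = (annulus (\<rho> / 4) \<rho> :: 'a set)"
  have A: "A \<in> lmeasurable" "measure lebesgue A \<ge> 3 / 4 * (V * \<rho> ^ ?D)"
  proof -
    have eq: "A = cball 0 \<rho> - ball 0 (\<rho> / 4)" by (auto simp: A_def)
    show "A \<in> lmeasurable" unfolding eq by (intro fmeasurable_Diff) auto
    have "measure lebesgue A = measure lebesgue (cball (0::'a) \<rho>) - measure lebesgue (ball (0::'a) (\<rho> / 4))"
      unfolding eq using \<rho> by (intro measurable_measure_Diff) auto
    also have "measure lebesgue (cball (0::'a) \<rho>) = V * \<rho> ^ ?D"
      using \<rho> by (simp add: content_cball V_def)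
    also have "measure lebesgue (ball (0::'a) (\<rho> / 4)) = V * (\<rho> / 4) ^ ?D"
      using \<rho> by (simp add: content_ball V_def)
    finally have eq': "measure lebesgue A = V * \<rho> ^ ?D - V * (\<rho> / 4) ^ ?D" .
    have "(\<rho> / 4) ^ ?D \<le> \<rho> ^ ?D / 4"
    proof -
      have "(4::real) ^ 1 \<le> 4 ^ ?D" using DIM_positive by (intro power_increasing) auto
      then have "\<rho> ^ ?D / 4 ^ ?D \<le> \<rho> ^ ?D / 4" using \<rho> by (intro divide_left_mono) auto
      then show ?thesis by (simp add: power_divide)
    qed
    then have "V * (\<rho> / 4) ^ ?D \<le> V * (\<rho> ^ ?D / 4)" using V by (intro mult_left_mono) auto
    then show "measure lebesgue A \<ge> 3 / 4 * (V * \<rho> ^ ?D)" unfolding eq' by simp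
  qed
  have main: "m < (LINT z|lebesgue. indicator (A - E) z * riesz s z)"
    if E: "E \<in> lmeasurable" "measure lebesgue E \<le> \<epsilon>" for E
  proof -
    have AE: "A - E \<in> lmeasurable" using A E by (intro fmeasurable_Diff) auto
    have "measure lebesgue A - measure lebesgue E \<le> measure lebesgue (A - E)"
      using measure_Un_le[of "A - E" lebesgue E] measure_mono_fmeasurable[of A "(A - E) \<union> E" lebesgue]
        A E AE fmeasurable.Un[OF AE E(1)] by (fastforce simp: fmeasurableD)
    then have half: "V * \<rho> ^ ?D / 2 \<le> measure lebesgue (A - E)" using A(2) E(2) by (simp add: \<epsilon>_def)
    have "m < V / 2 * \<rho> powr (- (2 * s))" by (rule \<rho>)
    also have "\<dots> = (1 / \<rho> powr ?p) * (V * \<rho> ^ ?D / 2)"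
      using \<rho> by (simp add: powr_add powr_minus powr_realpow field_simps)
    also have "\<dots> \<le> (1 / \<rho> powr ?p) * measure lebesgue (A - E)"
      using half by (intro mult_left_mono) auto
    also have "\<dots> = (LINT z|lebesgue. (1 / \<rho> powr ?p) * indicator (A - E) z)"
      using AE by simp
    also have "\<dots> \<le> (LINT z|lebesgue. indicator (A - E) z * riesz s z)"
    proof (rule integral_mono)
      show "integrable lebesgue (\<lambda>z. (1 / \<rho> powr ?p) * indicator (A - E) z)"
        using AE by (intro integrable_mult_right integrable_real_indicator) (auto simp: fmeasurable_def)
      have "integrable lebesgue (\<lambda>z. indicator (A - E) z *\<^sub>R (indicator A z * riesz s z))"
        using annulus_mass_integrable[OF s, of "\<rho> / 4" \<rho>] \<rho> AE unfolding A_def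
        by (intro integrable_mult_indicator) auto
      also have "(\<lambda>z. indicator (A - E) z *\<^sub>R (indicator A z * riesz s z)) = (\<lambda>z. indicator (A - E) z * riesz s z)"
        by (auto simp: indicator_def)
      finally show "integrable lebesgue (\<lambda>z. indicator (A - E) z * riesz s z)" .
      show "1 / \<rho> powr ?p * indicator (A - E) z \<le> indicator (A - E) z * riesz s z" for z
      proof (cases "z \<in> A - E")
        case True
        then have z: "0 < norm z" "norm z \<le> \<rho>" using \<rho>(1) by (auto simp: A_def)
        then have "norm z powr ?p \<le> \<rho> powr ?p" using s by (intro powr_mono2) auto
        then have "1 / \<rho> powr ?p \<le> 1 / norm z powr ?p" using z \<rho> by (intro divide_left_mono) auto
        then show ?thesis using True by (simp add: riesz_def)
      qed simp
    qed
    finally show ?thesis .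
  qed
  have "\<epsilon> > 0" "\<rho> / 4 > 0" using V \<rho> by (auto simp: \<epsilon>_def)
  then show ?thesis using main unfolding A_def by blast
qed

section \<open>Operators with bounded homogeneous kernels\<close>

locale stable_operators =
  fixes s lam Lam :: real and \<L> :: "(('a::euclidean_space \<Rightarrow> real) \<Rightarrow> 'a \<Rightarrow> real) set"
  assumes s: "0 < s" "s < 1" and lam: "0 < lam" "lam \<le> Lam"
    and LL: "\<L> \<subseteq> L_star s lam Lam" "\<L> \<noteq> {}"

definition hom_kernel :: "real \<Rightarrow> ('a::euclidean_space \<Rightarrow> real) \<Rightarrow> 'a \<Rightarrow> real" where
  "hom_kernel s k z = k (z /\<^sub>R norm z) / norm z powr (real DIM('a) + 2 * s)"

lemma L_op_second_diff:
  "L_op s k u x = 1 / 2 * (LINT z|lebesgue. second_diff u x z * hom_kernel s k z)"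
  by (simp add: L_op_def second_diff_def hom_kernel_def)

lemma hom_kernel_measurable:
  assumes "k \<in> kernel_class lam Lam"
  shows "hom_kernel s (k :: 'a::euclidean_space \<Rightarrow> real) \<in> borel_measurable lebesgue"
proof -
  have "(\<lambda>z::'a. norm z powr (real DIM('a) + 2 * s)) \<in> borel_measurable lebesgue"
    by (rule borel_imp_lebesgue_measurable) measurable
  then show ?thesis
    using assms unfolding hom_kernel_def kernel_class_def
    by (intro borel_measurable_divide) auto
qed

lemma hom_kernel_bounds:
  assumes "k \<in> kernel_class lam Lam"
  shows "AE z in lebesgue. lam * riesz s z \<le> hom_kernel s k z \<and> hom_kernel s k z \<le> Lam * riesz s z"
proof -
  have "AE z in lebesgue. lam \<le> k (z /\<^sub>R norm z) \<and> k (z /\<^sub>R norm z) \<le> Lam"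
    using assms by (simp add: kernel_class_def)
  then show ?thesis
    by eventually_elim (auto simp: hom_kernel_def riesz_def intro!: divide_right_mono)
qed

lemma hom_kernel_integrable:
  fixes h :: "'a::euclidean_space \<Rightarrow> real"
  assumes k: "k \<in> kernel_class lam Lam" and lam: "0 < lam" "lam \<le> Lam"
    and h: "h \<in> borel_measurable borel" "integrable lebesgue (\<lambda>z. h z * riesz s z)"
  shows "integrable lebesgue (\<lambda>z. h z * hom_kernel s k z)"
    and "(LINT z|lebesgue. h z * hom_kernel s k z) \<le> Lam * (LINT z|lebesgue. \<bar>h z * riesz s z\<bar>)"
proof -
  have ae: "AE z in lebesgue. \<bar>h z * hom_kernel s k z\<bar> \<le> Lam * \<bar>h z * riesz s z\<bar>"
    using hom_kernel_bounds[OF k]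
  proof eventually_elim
    fix z :: 'a assume z: "lam * riesz s z \<le> hom_kernel s k z \<and> hom_kernel s k z \<le> Lam * riesz s z"
    have "0 \<le> lam * riesz s z" using lam riesz_nonneg[of s z] by simp
    then have "\<bar>hom_kernel s k z\<bar> \<le> Lam * riesz s z" using z by linarith
    then have "\<bar>h z\<bar> * \<bar>hom_kernel s k z\<bar> \<le> \<bar>h z\<bar> * (Lam * riesz s z)"
      by (intro mult_left_mono) auto
    then show "\<bar>h z * hom_kernel s k z\<bar> \<le> Lam * \<bar>h z * riesz s z\<bar>"
      using riesz_nonneg[of s z] by (simp add: abs_mult mult_ac)
  qed
  show int: "integrable lebesgue (\<lambda>z. h z * hom_kernel s k z)"
  proof (rule Bochner_Integration.integrable_bound)
    show "integrable lebesgue (\<lambda>z. Lam * \<bar>h z * riesz s z\<bar>)" using h(2) by simp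
    show "(\<lambda>z. h z * hom_kernel s k z) \<in> borel_measurable lebesgue"
      using borel_imp_lebesgue_measurable[OF h(1)] hom_kernel_measurable[OF k] by measurable
    show "AE z in lebesgue. norm (h z * hom_kernel s k z) \<le> norm (Lam * \<bar>h z * riesz s z\<bar>)"
      using ae by eventually_elim auto
  qed
  have "(LINT z|lebesgue. h z * hom_kernel s k z) \<le> (LINT z|lebesgue. Lam * \<bar>h z * riesz s z\<bar>)"
    using ae h(2) int by (intro integral_mono_AE) (auto elim!: eventually_mono)
  then show "(LINT z|lebesgue. h z * hom_kernel s k z) \<le> Lam * (LINT z|lebesgue. \<bar>h z * riesz s z\<bar>)"
    by simp
qed

lemma L_op_uminus: "L_op s k (\<lambda>x. - u x) x = - L_op s k u x"
proof -
  have "second_diff (\<lambda>x. - u x) x z * hom_kernel s k z = - (second_diff u x z * hom_kernel s k z)" for z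
    by (simp add: second_diff_def algebra_simps)
  then show ?thesis by (simp add: L_op_second_diff)
qed

lemma L1_omega_uminus: "u \<in> L1_omega s \<Longrightarrow> (\<lambda>x. - u x) \<in> L1_omega s"
  by (simp add: L1_omega_def)

lemma L_op_cmult: "L_op s k (\<lambda>x. t * u x) x = t * L_op s k u x"
proof -
  have "(\<lambda>z. second_diff (\<lambda>x. t * u x) x z * hom_kernel s k z)
      = (\<lambda>z. t * (second_diff u x z * hom_kernel s k z))"
    by (simp add: second_diff_def algebra_simps)
  then show ?thesis by (simp add: L_op_second_diff)
qed

lemma L1_omega_cmult: "u \<in> L1_omega s \<Longrightarrow> (\<lambda>x. t * u x) \<in> L1_omega s"
  by (simp add: L1_omega_def mult.assoc)

section \<open>Paraboloid test functions\<close>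

definition quadratic :: "real \<Rightarrow> 'a::euclidean_space \<Rightarrow> real \<Rightarrow> 'a \<Rightarrow> 'a \<Rightarrow> real" where
  "quadratic a b c x0 x = a + b \<bullet> (x - x0) + c * (norm (x - x0))\<^sup>2"

lemma quadratic_has_derivative:
  "(quadratic a b c x0 has_derivative (\<lambda>h. b \<bullet> h + 2 * c * ((x - x0) \<bullet> h))) (at x)"
  unfolding quadratic_def power2_norm_eq_inner
  by (auto intro!: derivative_eq_intros simp: inner_commute algebra_simps)

lemma partial_deriv_quadratic:
  "partial_deriv i (quadratic a b c x0) = quadratic (b \<bullet> i) ((2 * c) *\<^sub>R i) 0 x0"
proof
  fix x
  have "partial_deriv i (quadratic a b c x0) x = b \<bullet> i + 2 * c * ((x - x0) \<bullet> i)"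
    unfolding partial_deriv_def
    using frechet_derivative_at[OF quadratic_has_derivative[of a b c x0 x]] by metis
  then show "partial_deriv i (quadratic a b c x0) x = quadratic (b \<bullet> i) ((2 * c) *\<^sub>R i) 0 x0 x"
    by (simp add: quadratic_def inner_commute)
qed

lemma continuous_on_quadratic: "continuous_on S (quadratic a b c x0)"
  unfolding quadratic_def by (intro continuous_intros)

text \<open>Partial derivatives of quadratic functions are again quadratic functions of the same form, so that
  induction gives smoothness of every order.\<close>

lemma C_closure_quadratic: "C_closure k (quadratic a b c x0) N"
proof (induction k arbitrary: a b c)
  case 0
  show ?case by (auto simp: extends_continuously_def intro: continuous_on_quadratic)
next
  case (Suc k)
  show ?case
    using Suc.IH
    by (auto simp: extends_continuously_def partial_deriv_quadratic differentiable_def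
        intro: continuous_on_quadratic quadratic_has_derivative)
qed

lemma quadratic_center [simp]: "quadratic a b c x0 x0 = a"
  by (simp add: quadratic_def)

definition glue :: "('a::euclidean_space \<Rightarrow> real) \<Rightarrow> 'a \<Rightarrow> 'a \<Rightarrow> real \<Rightarrow> real \<Rightarrow> 'a \<Rightarrow> real" where
  "glue u x0 b c \<delta> x = (if x \<in> ball x0 \<delta> then quadratic (u x0) b c x0 x else u x)"

text \<open>The second differences of \<open>glue u x0 b c \<delta>\<close> at \<open>x0\<close>; the linear term \<open>b\<close> cancels.\<close>

definition glued_diff :: "('a::euclidean_space \<Rightarrow> real) \<Rightarrow> 'a \<Rightarrow> real \<Rightarrow> real \<Rightarrow> 'a \<Rightarrow> real" where
  "glued_diff u x0 c \<delta> z = (if norm z < \<delta> then 2 * c * (norm z)\<^sup>2 else second_diff u x0 z)"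

lemma second_diff_glue:
  assumes "0 < \<delta>"
  shows "second_diff (glue u x0 b c \<delta>) x0 z = glued_diff u x0 c \<delta> z"
  using assms
  by (simp add: second_diff_def glued_diff_def glue_def quadratic_def dist_norm algebra_simps)

lemma quadratic_cmult:
  "t \<noteq> 0 \<Longrightarrow> quadratic (t * a) b c x0 x = t * quadratic a (b /\<^sub>R t) (c / t) x0 x"
  by (simp add: quadratic_def distrib_left mult.assoc[symmetric])

lemma glue_cmult:
  "t \<noteq> 0 \<Longrightarrow> glue (\<lambda>x. t * u x) x0 b c \<delta> = (\<lambda>x. t * glue u x0 (b /\<^sub>R t) (c / t) \<delta> x)"
  by (auto simp: glue_def quadratic_cmult)

text \<open>Viscosity inequalities tested only with paraboloids on balls.  These are the test functions that the doubling of
  variables produces, and the second differences of the glued functions at the centre are explicit.\<close>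

definition paraboloid_sub :: "(('a::euclidean_space \<Rightarrow> real) \<Rightarrow> 'a \<Rightarrow> real) set \<Rightarrow> 'a set \<Rightarrow>
    ('a \<Rightarrow> real) \<Rightarrow> ('a \<Rightarrow> real) \<Rightarrow> bool" where
  "paraboloid_sub \<L> \<Omega> u f \<longleftrightarrow>
     (\<forall>x0\<in>\<Omega>. \<forall>b c \<delta>. 0 < \<delta> \<and> ball x0 \<delta> \<subseteq> \<Omega> \<and>
        (\<forall>x\<in>ball x0 \<delta> - {x0}. u x < quadratic (u x0) b c x0 x) \<longrightarrow>
        f x0 \<le> I_op \<L> (glue u x0 b c \<delta>) x0)"

definition paraboloid_super :: "(('a::euclidean_space \<Rightarrow> real) \<Rightarrow> 'a \<Rightarrow> real) set \<Rightarrow> 'a set \<Rightarrow>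
    ('a \<Rightarrow> real) \<Rightarrow> ('a \<Rightarrow> real) \<Rightarrow> bool" where
  "paraboloid_super \<L> \<Omega> u f \<longleftrightarrow>
     (\<forall>x0\<in>\<Omega>. \<forall>b c \<delta>. 0 < \<delta> \<and> ball x0 \<delta> \<subseteq> \<Omega> \<and>
        (\<forall>x\<in>ball x0 \<delta> - {x0}. quadratic (u x0) b c x0 x < u x) \<longrightarrow>
        I_op \<L> (glue u x0 b c \<delta>) x0 \<le> f x0)"

lemma visc_ge_imp_paraboloid_sub:
  assumes "visc_ge \<L> \<Omega> u f"
  shows "paraboloid_sub \<L> \<Omega> u f"
  unfolding paraboloid_sub_def
proof (intro ballI allI impI, elim conjE)
  fix x0 b c \<delta>
  assume "x0 \<in> \<Omega>" "0 < \<delta>" "ball x0 \<delta> \<subseteq> \<Omega>"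
    and lt: "\<forall>x\<in>ball x0 \<delta> - {x0}. u x < quadratic (u x0) b c x0 x"
  then have "f x0 \<le> I_op \<L> (\<lambda>x. if x \<in> ball x0 \<delta> then quadratic (u x0) b c x0 x else u x) x0"
    by (intro assms[unfolded visc_ge_def, rule_format])
      (auto simp: C_closure_quadratic)
  then show "f x0 \<le> I_op \<L> (glue u x0 b c \<delta>) x0"
    by (simp add: glue_def[abs_def])
qed

lemma visc_le_imp_paraboloid_super:
  assumes "visc_le \<L> \<Omega> u f"
  shows "paraboloid_super \<L> \<Omega> u f"
  unfolding paraboloid_super_def
proof (intro ballI allI impI, elim conjE)
  fix x0 b c \<delta>
  assume "x0 \<in> \<Omega>" "0 < \<delta>" "ball x0 \<delta> \<subseteq> \<Omega>"
    and lt: "\<forall>x\<in>ball x0 \<delta> - {x0}. quadratic (u x0) b c x0 x < u x"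
  then have "I_op \<L> (\<lambda>x. if x \<in> ball x0 \<delta> then quadratic (u x0) b c x0 x else u x) x0 \<le> f x0"
    by (intro assms[unfolded visc_le_def, rule_format])
      (auto simp: C_closure_quadratic)
  then show "I_op \<L> (glue u x0 b c \<delta>) x0 \<le> f x0"
    by (simp add: glue_def[abs_def])
qed

lemma L_op_glue:
  "0 < \<delta> \<Longrightarrow> L_op s k (glue u x0 b c \<delta>) x0
     = 1 / 2 * (LINT z|lebesgue. glued_diff u x0 c \<delta> z * hom_kernel s k z)"
  by (simp add: L_op_second_diff second_diff_glue)

lemma glued_diff_measurable:
  "continuous_on UNIV u \<Longrightarrow> glued_diff u x c \<delta> \<in> borel_measurable borel"
proof -
  assume "continuous_on UNIV u"
  then have [measurable]: "u \<in> borel_measurable borel" by (rule borel_measurable_continuous_onI)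
  show ?thesis unfolding glued_diff_def second_diff_def by measurable
qed

lemma glued_diff_integrable:
  fixes u :: "'a::euclidean_space \<Rightarrow> real"
  assumes s: "0 < s" "s < 1" and u: "continuous_on UNIV u" "u \<in> L1_omega s" and d: "0 < \<delta>"
  shows "integrable lebesgue (\<lambda>z. glued_diff u x c \<delta> z * riesz s z)"
proof -
  define near :: "'a \<Rightarrow> real" where "near = (\<lambda>z. if norm z < \<delta> then (norm z)\<^sup>2 else 0)"
  define far :: "'a \<Rightarrow> real" where "far = (\<lambda>z. if norm z < \<delta> then 0 else 1)"
  have i1: "integrable lebesgue (\<lambda>z. near z * riesz s z)"
  proof (rule riesz_integrable_of_bound[OF s])
    show "near \<in> borel_measurable borel" unfolding near_def by measurable
    show "\<bar>near z\<bar> \<le> (1 + \<delta>\<^sup>2) * min 1 ((norm z)\<^sup>2)" for z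
      using inside_bound[of z \<delta>] by (auto simp: near_def)
  qed
  have i2: "integrable lebesgue (\<lambda>z. far z * riesz s z)"
  proof (rule riesz_integrable_of_bound[OF s])
    show "far \<in> borel_measurable borel" unfolding far_def by measurable
    show "\<bar>far z\<bar> \<le> (1 + 1 / \<delta>\<^sup>2) * min 1 ((norm z)\<^sup>2)" for z
      using outside_bound[of \<delta> z] d by (auto simp: far_def)
  qed
  note i3 = tail_integrable[OF s(1) u d, of 1 x] and i4 = tail_integrable[OF s(1) u d, of "-1" x]
  have "integrable lebesgue (\<lambda>z. 2 * c * (near z * riesz s z)
      + (indicator {z. \<delta> \<le> norm z} z * u (x + 1 *\<^sub>R z) * riesz s z)
      + (indicator {z. \<delta> \<le> norm z} z * u (x + (-1) *\<^sub>R z) * riesz s z)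
      - 2 * u x * (far z * riesz s z))"
    using i1 i2 i3 i4 by simp
  also have "(\<lambda>z. 2 * c * (near z * riesz s z)
      + (indicator {z. \<delta> \<le> norm z} z * u (x + 1 *\<^sub>R z) * riesz s z)
      + (indicator {z. \<delta> \<le> norm z} z * u (x + (-1) *\<^sub>R z) * riesz s z)
      - 2 * u x * (far z * riesz s z)) = (\<lambda>z. glued_diff u x c \<delta> z * riesz s z)"
    by (auto simp: glued_diff_def near_def far_def second_diff_def algebra_simps)
  finally show ?thesis .
qed

text \<open>The supremum defining \<open>I_op\<close> is a supremum of reals; its upper bound property requires this
  boundedness.\<close>

lemma (in stable_operators) bdd_above_glue:
  assumes u: "continuous_on UNIV u" "u \<in> L1_omega s" and d: "0 < \<delta>"
  shows "bdd_above ((\<lambda>L. L (glue u x b c \<delta>) x) ` \<L>)"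
proof -
  have "L (glue u x b c \<delta>) x \<le> 1 / 2 * (Lam * (LINT z|lebesgue. \<bar>glued_diff u x c \<delta> z * riesz s z\<bar>))"
    if L: "L \<in> \<L>" for L
  proof -
    obtain k where k: "k \<in> kernel_class lam Lam" "L = L_op s k"
      using LL L by (auto simp: L_star_def)
    show ?thesis
      unfolding k(2) L_op_glue[OF d]
      using hom_kernel_integrable(2)[OF k(1) lam glued_diff_measurable[OF u(1)] glued_diff_integrable[OF s u d]]
      by simp
  qed
  then show ?thesis by (intro bdd_aboveI2) 
qed

lemma (in stable_operators) le_I_op_glue:
  assumes u: "continuous_on UNIV u" "u \<in> L1_omega s" and d: "0 < \<delta>" and L: "L \<in> \<L>"
  shows "L (glue u x b c \<delta>) x \<le> I_op \<L> (glue u x b c \<delta>) x"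
  unfolding I_op_def by (rule cSUP_upper[OF L bdd_above_glue[OF u d]])

text \<open>A single operator \<open>L\<close> of the class shows \<open>I v \<ge> L v = - L (- v) \<ge> - I (- v)\<close>.\<close>

lemma (in stable_operators) paraboloid_sub_uminus:
  assumes u: "continuous_on UNIV u" "u \<in> L1_omega s" and super: "paraboloid_super \<L> \<Omega> u f"
  shows "paraboloid_sub \<L> \<Omega> (\<lambda>x. - u x) (\<lambda>x. - f x)"
  unfolding paraboloid_sub_def
proof (intro ballI allI impI, elim conjE)
  fix x0 b c \<delta>
  assume x0: "x0 \<in> \<Omega>" and d: "0 < \<delta>" and sub: "ball x0 \<delta> \<subseteq> \<Omega>"
    and lt: "\<forall>x\<in>ball x0 \<delta> - {x0}. - u x < quadratic (- u x0) b c x0 x"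
  have q: "quadratic (- u x0) b c x0 x = - quadratic (u x0) (- b) (- c) x0 x" for x
    by (simp add: quadratic_def)
  have g: "glue (\<lambda>x. - u x) x0 b c \<delta> = (\<lambda>x. - glue u x0 (- b) (- c) \<delta> x)"
    by (auto simp: glue_def q)
  obtain L where L: "L \<in> \<L>" using LL by blast
  then obtain k where k: "L = L_op s k" using LL by (auto simp: L_star_def)
  have "L (glue u x0 (- b) (- c) \<delta>) x0 \<le> I_op \<L> (glue u x0 (- b) (- c) \<delta>) x0"
    by (rule le_I_op_glue[OF u d L])
  also have "\<dots> \<le> f x0"
    using super x0 d sub lt unfolding paraboloid_super_def q by auto
  finally have "- f x0 \<le> L (glue (\<lambda>x. - u x) x0 b c \<delta>) x0"
    unfolding g k L_op_uminus by simp
  also have "\<dots> \<le> I_op \<L> (glue (\<lambda>x. - u x) x0 b c \<delta>) x0"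
    using u L1_omega_uminus by (intro le_I_op_glue[OF _ _ d L]) (auto intro: continuous_intros)
  finally show "- f x0 \<le> I_op \<L> (glue (\<lambda>x. - u x) x0 b c \<delta>) x0" .
qed

section \<open>Doubling of variables at a maximum point\<close>

lemma small_ball_mass_tendsto_0:
  fixes s :: real
  assumes s: "0 < s" "s < 1" and d: "0 < d" "d \<le> 1"
  shows "(\<lambda>n. LINT z::'a::euclidean_space|lebesgue.
            (if norm z < d / real (Suc n) then (norm z)\<^sup>2 else 0) * riesz s z) \<longlonglongrightarrow> 0"
proof -
  have "(\<lambda>n. LINT z::'a|lebesgue. (if norm z < d / real (Suc n) then (norm z)\<^sup>2 else 0) * riesz s z)
      \<longlonglongrightarrow> (LINT z::'a|lebesgue. 0)"
  proof (rule integral_dominated_convergence[where w = "\<lambda>z. min 1 ((norm z)\<^sup>2) * riesz s z"])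
    show "(\<lambda>z::'a. (if norm z < d / real (Suc n) then (norm z)\<^sup>2 else 0) * riesz s z)
        \<in> borel_measurable lebesgue" for n
      by (rule borel_imp_lebesgue_measurable) measurable
    show "integrable lebesgue (\<lambda>z::'a. min 1 ((norm z)\<^sup>2) * riesz s z)"
      by (rule min_riesz_integrable[OF s])
    show "AE z::'a in lebesgue. (\<lambda>n. (if norm z < d / real (Suc n) then (norm z)\<^sup>2 else 0) * riesz s z)
        \<longlonglongrightarrow> 0"
    proof (rule AE_I2)
      fix z :: 'a
      show "(\<lambda>n. (if norm z < d / real (Suc n) then (norm z)\<^sup>2 else 0) * riesz s z) \<longlonglongrightarrow> 0"
      proof (cases "z = 0")
        case False
        have "(\<lambda>n. d / real (Suc n)) \<longlonglongrightarrow> 0"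
          using LIMSEQ_Suc[OF lim_const_over_n[of d]] by simp
        then have "\<forall>\<^sub>F n in sequentially. d / real (Suc n) < norm z"
          using False by (intro order_tendstoD(2)[where y = 0]) auto
        then have "\<forall>\<^sub>F n in sequentially. (if norm z < d / real (Suc n) then (norm z)\<^sup>2 else 0) * riesz s z = 0"
          by eventually_elim auto
        then show ?thesis by (rule tendsto_eventually)
      qed (simp add: riesz_def)
    qed
    show "AE z::'a in lebesgue. norm ((if norm z < d / real (Suc n) then (norm z)\<^sup>2 else 0) * riesz s z)
        \<le> min 1 ((norm z)\<^sup>2) * riesz s z" for n
    proof (rule AE_I2)
      fix z :: 'a
      have "d / real (Suc n) \<le> 1" using d by (simp add: field_simps)
      then have "norm z < d / real (Suc n) \<Longrightarrow> (norm z)\<^sup>2 \<le> 1"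
        by (intro power_le_one norm_ge_zero) linarith
      then show "norm ((if norm z < d / real (Suc n) then (norm z)\<^sup>2 else 0) * riesz s z)
          \<le> min 1 ((norm z)\<^sup>2) * riesz s z"
        by (auto simp: min_def abs_mult riesz_nonneg)
    qed
  qed simp
  then show ?thesis by simp
qed

text \<open>Subtract the two viscosity inequalities for the functions that are glued with paraboloids of radius
  \<open>\<delta>\<close>, and select an operator \<open>L\<close> that is almost optimal for the first one.  The second differences then satisfy
  three bounds: they are at most \<open>4 c |z|\<^sup>2\<close> for \<open>|z| < \<delta>\<close>, at most \<open>H\<close> beyond, and on the annulus the
  difference minus \<open>H\<close> is nonpositive, so that the kernel can be replaced there by its lower bound
  \<open>lam * riesz s\<close>.  The first contribution vanishes as \<open>\<delta> \<rightarrow> 0\<close>.\<close>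

lemma (in stable_operators) touching_pair_inequality:
  fixes u v :: "'a::euclidean_space \<Rightarrow> real"
  assumes u: "continuous_on UNIV u" "u \<in> L1_omega s" and v: "continuous_on UNIV v" "v \<in> L1_omega s"
    and sub: "paraboloid_sub \<L> \<Omega> u f" and super: "paraboloid_super \<L> \<Omega> v g"
    and xy: "x \<in> \<Omega>" "y \<in> \<Omega>" and d0: "0 < d0" "ball x d0 \<subseteq> \<Omega>" "ball y d0 \<subseteq> \<Omega>" and c: "0 \<le> c"
    and ux: "\<And>h. h \<noteq> 0 \<Longrightarrow> norm h < d0 \<Longrightarrow> u (x + h) < u x + b \<bullet> h + c * (norm h)\<^sup>2"
    and vy: "\<And>h. h \<noteq> 0 \<Longrightarrow> norm h < d0 \<Longrightarrow> v y + b' \<bullet> h - c * (norm h)\<^sup>2 < v (y + h)"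
    and H: "H \<in> borel_measurable borel" "\<And>z. 0 \<le> H z" "integrable lebesgue (\<lambda>z. H z * riesz s z)"
    and le: "\<And>z. second_diff u x z - second_diff v y z \<le> H z"
    and r: "0 < r"
  shows "2 * (f x - g y) \<le> Lam * (LINT z|lebesgue. H z * riesz s z)
     + lam * (LINT z|lebesgue. indicator (annulus r R) z
                * (second_diff u x z - second_diff v y z) * riesz s z)"
    (is "_ \<le> ?T")
proof -
  define A where "A = (annulus r R :: 'a set)"
  define G where "G = (\<lambda>z. second_diff u x z - second_diff v y z)"
  have intG: "integrable lebesgue (\<lambda>z. indicator A z * G z * riesz s z)"
  proof -
    have "integrable lebesgue (\<lambda>z. indicator A z * second_diff u x z * riesz s z
        - indicator A z * second_diff v y z * riesz s z)"
      using second_diff_annulus_integrable[OF s u(1) r] second_diff_annulus_integrable[OF s v(1) r]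
      unfolding A_def by (rule Bochner_Integration.integrable_diff)
    then show ?thesis by (simp add: G_def algebra_simps)
  qed
  define near where "near = (\<lambda>\<delta> z::'a. if norm z < \<delta> then (norm z)\<^sup>2 else 0)"
  have intN: "integrable lebesgue (\<lambda>z. near \<delta> z * riesz s z)" for \<delta>
  proof (rule riesz_integrable_of_bound[OF s])
    show "near \<delta> \<in> borel_measurable borel" unfolding near_def by measurable
    show "\<bar>near \<delta> z\<bar> \<le> (1 + \<delta>\<^sup>2) * min 1 ((norm z)\<^sup>2)" for z
      using inside_bound[of z \<delta>] by (auto simp: near_def)
  qed
  have step: "2 * (f x - g y) \<le> ?T + 4 * c * Lam * (LINT z|lebesgue. near \<delta> z * riesz s z)"
    if d: "0 < \<delta>" "\<delta> \<le> d0" "\<delta> < r" for \<delta>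
  proof (rule field_le_epsilon)
    fix e :: real assume e: "0 < e"
    have 1: "f x \<le> I_op \<L> (glue u x b c \<delta>) x"
    proof -
      have "u z < quadratic (u x) b c x z" if "z \<in> ball x \<delta> - {x}" for z
        using ux[of "z - x"] that d(2) by (auto simp: quadratic_def dist_norm norm_minus_commute)
      moreover have "ball x \<delta> \<subseteq> \<Omega>" using d0(2) d(2) subset_ball by blast
      ultimately show ?thesis using sub xy d(1) unfolding paraboloid_sub_def by blast
    qed
    have 2: "I_op \<L> (glue v y b' (- c) \<delta>) y \<le> g y"
    proof -
      have "quadratic (v y) b' (- c) y z < v z" if "z \<in> ball y \<delta> - {y}" for z
        using vy[of "z - y"] that d(2) by (auto simp: quadratic_def dist_norm norm_minus_commute)
      moreover have "ball y \<delta> \<subseteq> \<Omega>" using d0(3) d(2) subset_ball by blast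
      ultimately show ?thesis using super xy d(1) unfolding paraboloid_super_def by blast
    qed
    have "\<exists>L\<in>\<L>. f x - e / 2 < L (glue u x b c \<delta>) x"
    proof (rule ccontr)
      assume "\<not> ?thesis"
      then have "I_op \<L> (glue u x b c \<delta>) x \<le> f x - e / 2"
        unfolding I_op_def by (intro cSUP_least LL(2)) (auto simp: not_less)
      then show False using 1 e by simp
    qed
    then obtain L where L: "L \<in> \<L>" "f x - e / 2 < L (glue u x b c \<delta>) x" by blast
    obtain k where k: "k \<in> kernel_class lam Lam" "L = L_op s k"
      using LL L by (auto simp: L_star_def)
    let ?K = "hom_kernel s k"
    have 3: "L (glue v y b' (- c) \<delta>) y \<le> g y"
      using le_I_op_glue[OF v d(1) L(1)] 2 by (rule order_trans)
    have intu: "integrable lebesgue (\<lambda>z. glued_diff u x c \<delta> z * ?K z)"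
      by (rule hom_kernel_integrable(1)[OF k(1) lam glued_diff_measurable[OF u(1)]
            glued_diff_integrable[OF s u d(1)]])
    have intv: "integrable lebesgue (\<lambda>z. glued_diff v y (- c) \<delta> z * ?K z)"
      by (rule hom_kernel_integrable(1)[OF k(1) lam glued_diff_measurable[OF v(1)]
            glued_diff_integrable[OF s v d(1)]])
    have "2 * (f x - g y) - e
        \<le> (LINT z|lebesgue. glued_diff u x c \<delta> z * ?K z) - (LINT z|lebesgue. glued_diff v y (- c) \<delta> z * ?K z)"
      using L(2) 3 unfolding k(2) L_op_glue[OF d(1)] by (simp add: field_simps)
    also have "\<dots> = (LINT z|lebesgue. glued_diff u x c \<delta> z * ?K z - glued_diff v y (- c) \<delta> z * ?K z)"
      by (rule Bochner_Integration.integral_diff[OF intu intv, symmetric])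
    also have "\<dots> \<le> (LINT z|lebesgue. Lam * (H z * riesz s z) + lam * (indicator A z * G z * riesz s z)
        + 4 * c * Lam * (near \<delta> z * riesz s z))"
    proof (rule integral_mono_AE)
      show "integrable lebesgue (\<lambda>z. glued_diff u x c \<delta> z * ?K z - glued_diff v y (- c) \<delta> z * ?K z)"
        using intu intv by simp
      show "integrable lebesgue (\<lambda>z. Lam * (H z * riesz s z) + lam * (indicator A z * G z * riesz s z)
        + 4 * c * Lam * (near \<delta> z * riesz s z))"
        using H(3) intG intN by simp
      show "AE z in lebesgue. glued_diff u x c \<delta> z * ?K z - glued_diff v y (- c) \<delta> z * ?K z
        \<le> Lam * (H z * riesz s z) + lam * (indicator A z * G z * riesz s z)
          + 4 * c * Lam * (near \<delta> z * riesz s z)"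
        using hom_kernel_bounds[OF k(1)]
      proof eventually_elim
        fix z :: 'a
        assume K: "lam * riesz s z \<le> ?K z \<and> ?K z \<le> Lam * riesz s z"
        have K0: "0 \<le> ?K z" using K lam riesz_nonneg[of s z] mult_nonneg_nonneg[of lam "riesz s z"] by linarith
        have HK: "H z * ?K z \<le> Lam * (H z * riesz s z)"
          using mult_left_mono[OF conjunct2[OF K] H(2)[of z]] by (simp add: mult_ac)
        have HK0: "0 \<le> Lam * (H z * riesz s z)" using lam H(2) riesz_nonneg[of s z] by simp
        \<comment> \<open>The paraboloids act in the first case; there the annulus is absent because \<open>\<delta> < r\<close>.\<close>
        consider "norm z < \<delta>" | "\<not> norm z < \<delta>" "z \<notin> A" | "\<not> norm z < \<delta>" "z \<in> A" by blast
        then show "glued_diff u x c \<delta> z * ?K z - glued_diff v y (- c) \<delta> z * ?K z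
            \<le> Lam * (H z * riesz s z) + lam * (indicator A z * G z * riesz s z)
              + 4 * c * Lam * (near \<delta> z * riesz s z)"
        proof cases
          case 1
          then have "z \<notin> A" using d by (auto simp: A_def)
          have "4 * c * (norm z)\<^sup>2 * ?K z \<le> 4 * c * (norm z)\<^sup>2 * (Lam * riesz s z)"
            using K c by (intro mult_left_mono) auto
          then show ?thesis using 1 \<open>z \<notin> A\<close> HK0 by (simp add: glued_diff_def near_def mult_ac)
        next
          case 2
          have "G z * ?K z \<le> H z * ?K z" using le K0 unfolding G_def by (rule mult_right_mono)
          then show ?thesis using 2 HK by (simp add: glued_diff_def near_def G_def algebra_simps)
        next
          case 3
          have "(H z - G z) * (lam * riesz s z) \<le> (H z - G z) * ?K z"
            using K le[of z] unfolding G_def by (intro mult_left_mono) auto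
          moreover have "0 \<le> lam * riesz s z * H z" using lam riesz_nonneg[of s z] H(2) by simp
          ultimately have "G z * ?K z \<le> Lam * (H z * riesz s z) + lam * (G z * riesz s z)"
            using HK by (simp add: algebra_simps)
          then show ?thesis using 3 by (simp add: glued_diff_def near_def G_def left_diff_distrib)
        qed
      qed
    qed
    also have "\<dots> = Lam * (LINT z|lebesgue. H z * riesz s z) + lam * (LINT z|lebesgue. indicator A z * G z * riesz s z)
        + 4 * c * Lam * (LINT z|lebesgue. near \<delta> z * riesz s z)"
      using H(3) intG intN by simp
    finally show "2 * (f x - g y) \<le> ?T + 4 * c * Lam * (LINT z|lebesgue. near \<delta> z * riesz s z) + e"
      by (simp add: A_def G_def)
  qed
  define d where "d = min 1 (min d0 r) / 2"
  have d: "0 < d" "d \<le> 1" "d \<le> d0" "d < r" using d0 r by (auto simp: d_def)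
  have "2 * (f x - g y) \<le> ?T + 4 * c * Lam * (LINT z|lebesgue. near (d / real (Suc n)) z * riesz s z)" for n
  proof (rule step)
    have "d / real (Suc n) \<le> d" using d by (simp add: field_simps)
    then show "d / real (Suc n) \<le> d0" "d / real (Suc n) < r" using d by auto
  qed (use d in simp)
  moreover have "(\<lambda>n. ?T + 4 * c * Lam * (LINT z|lebesgue. near (d / real (Suc n)) z * riesz s z))
      \<longlonglongrightarrow> ?T + 4 * c * Lam * 0"
    unfolding near_def by (intro tendsto_intros small_ball_mass_tendsto_0[OF s d(1,2)])
  ultimately show ?thesis
    using LIMSEQ_le_const by fastforce
qed

text \<open>Doubling of variables: maximise \<open>u x - v y - n |x - y|\<^sup>2 - \<eta> |x - x1|\<^sup>2\<close> over \<open>x\<close> and \<open>y\<close> in a ball around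
  \<open>x1\<close>.  The maximum points tend to \<open>(x1, x1)\<close> as \<open>n \<rightarrow> \<infinity>\<close>, the term with \<open>\<eta>\<close> serving to localise them.  With
  one variable frozen, the maximum property provides touching paraboloids for \<open>u\<close> and \<open>v\<close>.  With both variables
  shifted by the same small \<open>z\<close>, it bounds the second differences, since the term with \<open>n\<close> does not
  change.  For large \<open>z\<close> the shifted points leave the ball, and the bound comes from the global maximum of
  \<open>u - v\<close> at \<open>x1\<close> instead; here uniform continuity of one of the functions transfers it from \<open>u x - v x\<close> to
  \<open>u x - v y\<close>.\<close>

lemma (in stable_operators) max_point_inequality:
  fixes u v :: "'a::euclidean_space \<Rightarrow> real"
  assumes u: "continuous_on UNIV u" "u \<in> L1_omega s" and v: "continuous_on UNIV v" "v \<in> L1_omega s"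
    and sub: "paraboloid_sub \<L> \<Omega> u f" and super: "paraboloid_super \<L> \<Omega> v g"
    and fg: "continuous_on UNIV f" "continuous_on UNIV g"
    and uc: "uniformly_continuous_on UNIV u \<or> uniformly_continuous_on UNIV v"
    and x1: "open \<Omega>" "x1 \<in> \<Omega>" and max: "\<And>x. u x - v x \<le> u x1 - v x1" and r: "0 < r"
  shows "2 * (f x1 - g x1) \<le> lam * truncated_laplacian s r R (\<lambda>x. u x - v x) x1"
proof -
  define M where "M = u x1 - v x1"
  define A where "A = (annulus r R :: 'a set)"
  define J where "J = (\<lambda>x y. LINT z|lebesgue. indicator A z * (second_diff u x z - second_diff v y z) * riesz s z)"
  \<comment> \<open>Global control of \<open>u x - v y\<close> near the diagonal.\<close>
  have near: "\<exists>d>0. \<forall>x y. dist x y < d \<longrightarrow> u x - v y \<le> M + e" if "0 < e" for e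
    using uc
  proof
    assume "uniformly_continuous_on UNIV u"
    from uniformly_continuous_onE[OF this that] obtain d
      where d: "d > 0" "\<And>x y. dist x y < d \<Longrightarrow> dist (u x) (u y) < e" by (metis UNIV_I)
    have "u x - v y \<le> M + e" if "dist x y < d" for x y
      using d(2)[OF that] max[of y] by (simp add: dist_real_def M_def)
    then show ?thesis using d(1) by blast
  next
    assume "uniformly_continuous_on UNIV v"
    from uniformly_continuous_onE[OF this that] obtain d
      where d: "d > 0" "\<And>x y. dist x y < d \<Longrightarrow> dist (v x) (v y) < e" by (metis UNIV_I)
    have "u x - v y \<le> M + e" if "dist x y < d" for x y
      using d(2)[OF that] max[of x] by (simp add: dist_real_def M_def)
    then show ?thesis using d(1) by blast
  qed
  obtain \<epsilon> where \<epsilon>: "\<epsilon> > 0" "cball x1 \<epsilon> \<subseteq> \<Omega>"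
    using x1 open_contains_cball by blast
  \<comment> \<open>The doubled maximum is taken in the ball of radius \<open>2 * \<rho>\<close>, so that points within \<open>\<rho>\<close> of \<open>x1\<close> can still be shifted by less than \<open>\<rho>\<close>.\<close>
  define \<rho> where "\<rho> = min 1 (\<epsilon> / 2)"
  have \<rho>: "0 < \<rho>" "\<rho> \<le> 1" using \<epsilon> by (auto simp: \<rho>_def)
  define K where "K = cball x1 (2 * \<rho>)"
  have K\<Omega>: "K \<subseteq> \<Omega>" using \<epsilon>(2) by (auto simp: K_def \<rho>_def)
  have K: "compact K" "x1 \<in> K" using \<rho> by (auto simp: K_def)
  have contK: "continuous_on (K \<times> K) (\<lambda>p. u (fst p))" "continuous_on (K \<times> K) (\<lambda>p. v (snd p))"
    by (auto intro!: continuous_on_compose2[OF u(1)] continuous_on_compose2[OF v(1)] continuous_intros)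
  define m where "m = (LINT z::'a|lebesgue. min 1 ((norm z)\<^sup>2) * riesz s z)"
  \<comment> \<open>The constant of \<open>outside_bound\<close>, doubled: \<open>\<eta> * C * min 1 |z|\<^sup>2\<close> dominates \<open>2 * \<eta> * |z|\<^sup>2\<close> for \<open>|z| < \<rho>\<close> and \<open>2 * \<eta>\<close> for \<open>|z| \<ge> \<rho>\<close>.\<close>
  define C where "C = 2 * (1 + 1 / \<rho>\<^sup>2)"
  have C: "C > 0" by (simp add: C_def add_pos_nonneg)
  have main: "2 * (f x1 - g x1) \<le> Lam * (\<eta> * C * m) + lam * J x1 x1" if \<eta>: "0 < \<eta>" for \<eta>
  proof -
    define \<Phi> where "\<Phi> = (\<lambda>n x y. u x - v y - real n * (norm (x - y))\<^sup>2 - \<eta> * (norm (x - x1))\<^sup>2)"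
    have "\<forall>n. \<exists>p. p \<in> K \<times> K \<and> (\<forall>q\<in>K \<times> K. \<Phi> n (fst q) (snd q) \<le> \<Phi> n (fst p) (snd p))"
    proof
      fix n
      have "continuous_on (K \<times> K) (\<lambda>p. \<Phi> n (fst p) (snd p))"
        unfolding \<Phi>_def by (intro continuous_intros contK)
      moreover have "compact (K \<times> K)" "K \<times> K \<noteq> {}" using K by (auto intro: compact_Times)
      ultimately show "\<exists>p. p \<in> K \<times> K \<and> (\<forall>q\<in>K \<times> K. \<Phi> n (fst q) (snd q) \<le> \<Phi> n (fst p) (snd p))"
        using continuous_attains_sup[of "K \<times> K" "\<lambda>p. \<Phi> n (fst p) (snd p)"] by blast
    qed
    then obtain P where P: "\<And>n. P n \<in> K \<times> K"
        "\<And>n q. q \<in> K \<times> K \<Longrightarrow> \<Phi> n (fst q) (snd q) \<le> \<Phi> n (fst (P n)) (snd (P n))"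
      unfolding choice_iff by blast
    define X Y where "X = (\<lambda>n. fst (P n))" and "Y = (\<lambda>n. snd (P n))"
    have X: "X n \<in> K" and Y: "Y n \<in> K" for n
      using P(1)[of n] by (auto simp: X_def Y_def mem_Times_iff)
    have XY: "\<Phi> n x y \<le> \<Phi> n (X n) (Y n)" if "x \<in> K" "y \<in> K" for n x y
      using P(2)[of "(x, y)" n] that by (simp add: X_def Y_def)
    \<comment> \<open>Comparison of the maximum with the value at \<open>(x1, x1)\<close>.\<close>
    have ge: "M + real n * (norm (X n - Y n))\<^sup>2 + \<eta> * (norm (X n - x1))\<^sup>2 \<le> u (X n) - v (Y n)" for n
      using XY[OF K(2) K(2), of n] by (simp add: \<Phi>_def M_def)
    have geM: "M \<le> u (X n) - v (Y n)" for n
    proof -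
      have "0 \<le> real n * (norm (X n - Y n))\<^sup>2" "0 \<le> \<eta> * (norm (X n - x1))\<^sup>2" using \<eta> by simp_all
      then show ?thesis using ge[of n] by linarith
    qed
    obtain B where B: "\<And>x y. x \<in> K \<Longrightarrow> y \<in> K \<Longrightarrow> u x - v y \<le> B"
    proof -
      have "continuous_on (K \<times> K) (\<lambda>p. u (fst p) - v (snd p))"
        by (intro continuous_intros contK)
      moreover have "compact (K \<times> K)" "K \<times> K \<noteq> {}" using K by (auto intro: compact_Times)
      ultimately obtain p where "\<forall>q\<in>K \<times> K. u (fst q) - v (snd q) \<le> u (fst p) - v (snd p)"
        using continuous_attains_sup[of "K \<times> K" "\<lambda>p. u (fst p) - v (snd p)"] by blast
      then show ?thesis using that[of "u (fst p) - v (snd p)"] by auto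
    qed
    have XY0: "\<forall>\<^sub>F n in sequentially. dist (X n) (Y n) < d" if d: "0 < d" for d
    proof -
      have "\<forall>\<^sub>F n in sequentially. (B - M) / d\<^sup>2 < real n"
        using eventually_gt_at_top filterlim_real_sequentially by (auto simp: filterlim_at_top_dense)
      then show ?thesis
      proof eventually_elim
        case (elim n)
        have "real n * (norm (X n - Y n))\<^sup>2 \<le> B - M"
        proof -
          have "0 \<le> \<eta> * (norm (X n - x1))\<^sup>2" using \<eta> by simp
          then show ?thesis using ge[of n] B[OF X Y, of n n] by linarith
        qed
        also have "\<dots> < real n * d\<^sup>2" using elim d by (simp add: field_simps)
        finally have "(norm (X n - Y n))\<^sup>2 < d\<^sup>2" by (simp add: mult_less_cancel_left)
        then show ?case using d by (simp add: dist_norm power2_less_imp_less)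
      qed
    qed
    have X1: "\<forall>\<^sub>F n in sequentially. dist (X n) x1 < d" if d: "0 < d" for d
    proof -
      have "0 < \<eta> * d\<^sup>2 / 2" using \<eta> d by simp
      from near[OF this] obtain d' where d': "d' > 0"
        "\<And>x y. dist x y < d' \<Longrightarrow> u x - v y \<le> M + \<eta> * d\<^sup>2 / 2" by blast
      show ?thesis using XY0[OF d'(1)]
      proof eventually_elim
        case (elim n)
        have "0 \<le> real n * (norm (X n - Y n))\<^sup>2" by simp
        then have "\<eta> * (norm (X n - x1))\<^sup>2 \<le> \<eta> * d\<^sup>2 / 2" using d'(2)[OF elim] ge[of n] by linarith
        also have "\<dots> < \<eta> * d\<^sup>2" using \<eta> d by simp
        finally have "(norm (X n - x1))\<^sup>2 < d\<^sup>2" using \<eta> by simp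
        then show ?case using d by (simp add: dist_norm power2_less_imp_less)
      qed
    qed
    have limX: "X \<longlonglongrightarrow> x1" using X1 by (simp add: tendsto_iff)
    have Y1: "\<forall>\<^sub>F n in sequentially. dist (Y n) x1 < d" if d: "0 < d" for d
    proof -
      have d2: "0 < d / 2" using d by simp
      show ?thesis using XY0[OF d2] X1[OF d2]
      proof eventually_elim
        case (elim n)
        then show ?case using dist_triangle[of "Y n" x1 "X n"] by (simp add: dist_commute)
      qed
    qed
    have limY: "Y \<longlonglongrightarrow> x1" using Y1 by (simp add: tendsto_iff)
    obtain d\<eta> where d\<eta>: "d\<eta> > 0" "\<And>x y. dist x y < d\<eta> \<Longrightarrow> u x - v y \<le> M + \<eta>"
      using near[OF \<eta>] by blast
    have ev: "\<forall>\<^sub>F n in sequentially. 2 * (f (X n) - g (Y n)) \<le> Lam * (\<eta> * C * m) + lam * J (X n) (Y n)"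
      using XY0[OF d\<eta>(1)] X1[OF \<rho>(1)] Y1[OF \<rho>(1)]
    proof eventually_elim
      case (elim n)
      define x y where "x = X n" and "y = Y n"
      have close: "dist x y < d\<eta>" "dist x x1 < \<rho>" "dist y x1 < \<rho>" using elim by (auto simp: x_def y_def)
      have inK: "x + h \<in> K" "y + h \<in> K" if "norm h < \<rho>" for h
        using that close dist_triangle[of x1 "x + h" x] dist_triangle[of x1 "y + h" y]
        by (auto simp: K_def dist_commute) (auto simp: dist_norm)
      have xK: "x \<in> K" "y \<in> K" using X Y by (auto simp: x_def y_def)
      have opt: "\<Phi> n x' y' \<le> \<Phi> n x y" if "x' \<in> K" "y' \<in> K" for x' y'
        using XY that by (simp add: x_def y_def)
      have Meq: "M \<le> u x - v y" using geM by (simp add: x_def y_def)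
      define H where "H = (\<lambda>z::'a. \<eta> * C * min 1 ((norm z)\<^sup>2))"
      have "2 * (f x - g y) \<le> Lam * (LINT z|lebesgue. H z * riesz s z)
          + lam * (LINT z|lebesgue. indicator (annulus r R) z
                * (second_diff u x z - second_diff v y z) * riesz s z)"
      \<comment> \<open>Expanding the squares gives opening \<open>n + \<eta>\<close> for \<open>u\<close> and \<open>n\<close> for \<open>v\<close>; the additional \<open>1\<close> makes the touching strict.\<close>
      proof (rule touching_pair_inequality[OF u v sub super _ _ \<rho>(1), where c = "real n + \<eta> + 1"
              and b = "(2 * real n) *\<^sub>R (x - y) + (2 * \<eta>) *\<^sub>R (x - x1)" and b' = "(2 * real n) *\<^sub>R (x - y)"])
        show "x \<in> \<Omega>" "y \<in> \<Omega>" using xK K\<Omega> by auto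
        show "ball x \<rho> \<subseteq> \<Omega>"
        proof
          fix p assume "p \<in> ball x \<rho>"
          then show "p \<in> \<Omega>" using inK(1)[of "p - x"] K\<Omega> by (auto simp: dist_norm norm_minus_commute)
        qed
        show "ball y \<rho> \<subseteq> \<Omega>"
        proof
          fix p assume "p \<in> ball y \<rho>"
          then show "p \<in> \<Omega>" using inK(2)[of "p - y"] K\<Omega> by (auto simp: dist_norm norm_minus_commute)
        qed
        show "0 \<le> real n + \<eta> + 1" using \<eta> by simp
        show "u (x + h) < u x + ((2 * real n) *\<^sub>R (x - y) + (2 * \<eta>) *\<^sub>R (x - x1)) \<bullet> h + (real n + \<eta> + 1) * (norm h)\<^sup>2"
          if "h \<noteq> 0" "norm h < \<rho>" for h
        proof -
          have 1: "(norm (x + h - p))\<^sup>2 = (norm (x - p))\<^sup>2 + 2 * ((x - p) \<bullet> h) + (norm h)\<^sup>2" for p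
            unfolding power2_norm_eq_inner by (simp add: inner_simps inner_commute)
          have pos: "0 < (norm h)\<^sup>2" using that by simp
          show ?thesis
            using opt[OF inK(1)[OF that(2)] xK(2)] unfolding \<Phi>_def 1
            by (simp add: inner_simps algebra_simps) (use pos in linarith)
        qed
        show "v y + ((2 * real n) *\<^sub>R (x - y)) \<bullet> h - (real n + \<eta> + 1) * (norm h)\<^sup>2 < v (y + h)"
          if "h \<noteq> 0" "norm h < \<rho>" for h
        proof -
          have 1: "(norm (x - (y + h)))\<^sup>2 = (norm (x - y))\<^sup>2 - 2 * ((x - y) \<bullet> h) + (norm h)\<^sup>2"
            unfolding power2_norm_eq_inner by (simp add: inner_simps inner_commute)
          have pos: "0 < (norm h)\<^sup>2" "0 < \<eta> * (norm h)\<^sup>2" using that \<eta> by simp_all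
          show ?thesis
            using opt[OF xK(1) inK(2)[OF that(2)]] unfolding \<Phi>_def 1
            by (simp add: inner_simps algebra_simps) (use pos in linarith)
        qed
        show "H \<in> borel_measurable borel" unfolding H_def by measurable
        show "0 \<le> H z" for z using C \<eta> by (simp add: H_def)
        show "integrable lebesgue (\<lambda>z. H z * riesz s z)"
          using min_riesz_integrable[OF s, where 'a = 'a] by (simp add: H_def mult.assoc)
        show "second_diff u x z - second_diff v y z \<le> H z" for z
        proof (cases "norm z < \<rho>")
          case True
          then have True': "norm (- z) < \<rho>" by simp
          have par: "(norm (x + z - x1))\<^sup>2 + (norm (x - z - x1))\<^sup>2 = 2 * (norm (x - x1))\<^sup>2 + 2 * (norm z)\<^sup>2"
            unfolding power2_norm_eq_inner by (simp add: inner_simps inner_commute)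
          have "\<Phi> n (x + z) (y + z) + \<Phi> n (x - z) (y - z) \<le> 2 * \<Phi> n x y"
            using opt[OF inK(1)[OF True] inK(2)[OF True]] opt[OF inK(1)[OF True'] inK(2)[OF True']] by simp
          then have "second_diff u x z - second_diff v y z
              \<le> \<eta> * ((norm (x + z - x1))\<^sup>2 + (norm (x - z - x1))\<^sup>2) - 2 * \<eta> * (norm (x - x1))\<^sup>2"
            unfolding \<Phi>_def second_diff_def by (simp add: algebra_simps)
          also have "\<dots> = 2 * \<eta> * (norm z)\<^sup>2" unfolding par by (simp add: algebra_simps)
          also have "\<dots> \<le> H z"
          proof -
            have "(norm z)\<^sup>2 \<le> 1" using True \<rho>(2) by (intro power_le_one) auto
            moreover have "2 \<le> C" by (simp add: C_def)
            ultimately show ?thesis using \<eta> by (simp add: H_def min_def mult_right_mono)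
          qed
          finally show ?thesis .
        next
          case False
          have "u (x + z) - v (y + z) \<le> M + \<eta>" "u (x - z) - v (y - z) \<le> M + \<eta>"
            using close(1) by (auto intro!: d\<eta>(2) simp: dist_norm)
          then have "second_diff u x z - second_diff v y z \<le> 2 * \<eta>"
            using Meq by (simp add: second_diff_def)
          also have "\<dots> \<le> 2 * \<eta> * ((1 + 1 / \<rho>\<^sup>2) * min 1 ((norm z)\<^sup>2))"
            using outside_bound[of \<rho> z] False \<rho>(1) \<eta> by simp
          also have "\<dots> = H z" unfolding H_def C_def by (simp only: mult_ac)
          finally show ?thesis .
        qed
      qed (use r in auto)
      moreover have "(LINT z|lebesgue. H z * riesz s z) = \<eta> * C * m"
        by (simp add: H_def m_def mult.assoc)
      ultimately show ?case by (simp add: J_def A_def x_def y_def)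
    qed
    have J_diff: "J x y = (LINT z|lebesgue. indicator A z * second_diff u x z * riesz s z)
        - (LINT z|lebesgue. indicator A z * second_diff v y z * riesz s z)" for x y
      unfolding J_def A_def
      by (subst Bochner_Integration.integral_diff[symmetric, OF second_diff_annulus_integrable[OF s u(1) r] second_diff_annulus_integrable[OF s v(1) r]])
        (simp add: algebra_simps)
    have limJ: "(\<lambda>n. J (X n) (Y n)) \<longlonglongrightarrow> J x1 x1"
      unfolding J_diff A_def
      using X Y by (intro tendsto_diff truncated_laplacian_tendsto[OF s _ r, where d = "2 * \<rho>"] u v limX limY)
        (auto simp: K_def)
    have "(\<lambda>n. f (X n)) \<longlonglongrightarrow> f x1" "(\<lambda>n. g (Y n)) \<longlonglongrightarrow> g x1"
      using fg limX limY by (auto simp: continuous_on_eq_continuous_at intro: isCont_tendsto_compose)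
    then show ?thesis
      by (intro tendsto_le[OF trivial_limit_sequentially _ _ ev] tendsto_intros limJ)
  qed
  have "2 * (f x1 - g x1) \<le> lam * J x1 x1 + e" if e: "0 < e" for e
  proof -
    have m: "0 \<le> m" unfolding m_def by (intro integral_nonneg_AE AE_I2) (simp add: riesz_nonneg)
    define q where "q = Lam * C * m + 1"
    have q: "q > 0" using lam C m by (simp add: q_def add_nonneg_pos)
    have "2 * (f x1 - g x1) \<le> Lam * (e / q * C * m) + lam * J x1 x1" using e q by (intro main) simp
    also have "Lam * (e / q * C * m) = e * ((Lam * C * m) / q)" by simp
    also have "\<dots> \<le> e * 1"
      using e q by (intro mult_left_mono) (auto simp: q_def)
    finally show ?thesis by simp
  qed
  then have "2 * (f x1 - g x1) \<le> lam * J x1 x1" by (rule field_le_epsilon)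
  also have "J x1 x1 = truncated_laplacian s r R (\<lambda>x. u x - v x) x1"
    unfolding J_def A_def second_diff_def by (simp add: algebra_simps)
  finally show ?thesis .
qed

section \<open>Maximum principles and simplicity\<close>

text \<open>Strong maximum principle: since \<open>w \<le> 0 = w x1\<close>, all second differences at \<open>x1\<close> are nonpositive, so they
  vanish almost everywhere; a point with \<open>w < 0\<close> would make them negative on an open set.  The kernel is
  positive at all nonzero increments, so this reaches every point of the space.\<close>

lemma vanishes_of_touching_zero:
  fixes w :: "'a::euclidean_space \<Rightarrow> real"
  assumes s: "0 < s" "s < 1" and w: "continuous_on UNIV w" and w0: "\<And>x. w x \<le> 0" and x1: "w x1 = 0"
    and int: "\<And>r R. 0 < r \<Longrightarrow> 0 \<le> truncated_laplacian s r R w x1"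
  shows "w x = 0"
proof (rule ccontr)
  assume "w x \<noteq> 0"
  then have wx: "w x < 0" "x \<noteq> x1" using w0[of x] x1 by auto
  define z0 where "z0 = x - x1"
  define r where "r = norm z0 / 2"
  define R where "R = 2 * norm z0"
  have z0: "z0 \<noteq> 0" using wx by (simp add: z0_def)
  then have r: "0 < r" by (simp add: r_def)
  let ?A = "(annulus r R :: 'a set)"
  define F where "F = (\<lambda>z. indicator ?A z * second_diff w x1 z * riesz s z)"
  have Fi: "integrable lebesgue F" unfolding F_def by (rule second_diff_annulus_integrable[OF s w r])
  have sd: "second_diff w x1 z \<le> w (x1 + z)" for z
    using w0[of "x1 - z"] x1 by (simp add: second_diff_def)
  have F0: "F z \<le> 0" for z
    using order_trans[OF sd w0, of z] riesz_nonneg[of s z]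
    by (auto simp: F_def indicator_def mult_nonpos_nonneg)
  have "(LINT z|lebesgue. - F z) \<le> 0" using int[OF r, of R] by (simp add: F_def)
  moreover have "0 \<le> (LINT z|lebesgue. - F z)" using F0 by (intro integral_nonneg_AE AE_I2) simp
  ultimately have "(LINT z|lebesgue. - F z) = 0" by simp
  then have ae: "AE z in lebesgue. - F z = 0"
    using Fi F0 by (subst (asm) integral_nonneg_eq_0_iff_AE) auto
  define S where "S = {z. r < norm z \<and> norm z < R \<and> w (x1 + z) < 0}"
  have "open S"
  proof -
    have cont: "continuous_on UNIV (\<lambda>z. w (x1 + z))"
      by (rule continuous_on_compose2[OF w]) (auto intro: continuous_intros)
    have "open {z::'a. r < norm z}" "open {z::'a. norm z < R}" "open {z. w (x1 + z) < 0}"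
      by (intro open_Collect_less continuous_intros cont)+
    moreover have "S = {z. r < norm z} \<inter> {z. norm z < R} \<inter> {z. w (x1 + z) < 0}"
      by (auto simp: S_def)
    ultimately show ?thesis by auto
  qed
  moreover have "z0 \<in> S" using z0 wx by (simp add: S_def r_def R_def z0_def)
  ultimately have "\<not> negligible S" using open_not_negligible by blast
  moreover have "negligible S"
  proof -
    have "F z < 0" if "z \<in> S" for z
    proof -
      have "second_diff w x1 z < 0" using sd[of z] that by (simp add: S_def)
      moreover have "z \<noteq> 0" "z \<in> ?A" using that r by (auto simp: S_def)
      ultimately show ?thesis using riesz_pos[of z s] by (simp add: F_def mult_neg_pos)
    qed
    then have "z \<notin> S" if "- F z = 0" for z using that by force
    then have "AE z in lebesgue. z \<notin> S" using ae by (rule eventually_mono[rotated])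
    then show ?thesis
      using \<open>open S\<close> by (simp add: negligible_iff_null_sets AE_iff_null_sets)
  qed
  ultimately show False by simp
qed

text \<open>The number \<open>b\<close> is the maximum of \<open>q / p\<close> on \<open>K\<close>; the second property also covers the empty set.\<close>

lemma compact_ratio_bound:
  fixes p q :: "'a::euclidean_space \<Rightarrow> real"
  assumes K: "compact K" and c: "continuous_on UNIV p" "continuous_on UNIV q"
    and p: "\<And>x. x \<in> K \<Longrightarrow> 0 < p x"
  obtains b where "\<And>x. x \<in> K \<Longrightarrow> q x \<le> b * p x"
    "\<And>T. (\<And>x. x \<in> K \<Longrightarrow> q x < T * p x) \<Longrightarrow> 0 < T \<Longrightarrow> b < T"
proof (cases "K = {}")
  case True
  then show ?thesis using that[of 0] by auto
next
  case False
  have "continuous_on K (\<lambda>x. q x / p x)"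
    using c p by (intro continuous_on_divide) (force intro: continuous_on_subset)+
  then obtain y where y: "y \<in> K" "\<And>x. x \<in> K \<Longrightarrow> q x / p x \<le> q y / p y"
    using continuous_attains_sup[OF K False] by blast
  show ?thesis
  proof (rule that[of "q y / p y"])
    show "q x \<le> q y / p y * p x" if "x \<in> K" for x
      using y(2)[OF that] p[OF that] by (simp add: pos_divide_le_eq)
    show "q y / p y < T" if "\<And>x. x \<in> K \<Longrightarrow> q x < T * p x" for T
      using that[OF y(1)] p[OF y(1)] by (simp add: pos_divide_less_eq)
  qed
qed

text \<open>The sliding argument.  Its input is only the conclusion of \<open>max_point_inequality\<close> for all \<open>q - t * p\<close>, so
  that it applies both to subsolutions above a positive eigenfunction and, after a change of sign, to
  supersolutions below a negative one; these cases are not exchanged by \<open>u \<mapsto> - u\<close>, because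
  \<open>I\<close> is not odd.\<close>

lemma proportional_of_max_inequality:
  fixes p q :: "'a::euclidean_space \<Rightarrow> real"
  assumes s: "0 < s" "s < 1" and lam: "0 < lam" and \<Omega>: "open \<Omega>" "bounded \<Omega>"
    and p: "continuous_on UNIV p" "\<And>x. x \<in> \<Omega> \<Longrightarrow> 0 < p x" "\<And>x. x \<notin> \<Omega> \<Longrightarrow> p x = 0"
    and q: "continuous_on UNIV q" "\<And>x. x \<notin> \<Omega> \<Longrightarrow> q x \<le> 0" "x0 \<in> \<Omega>" "0 < q x0"
    and ineq: "\<And>t x1 r R. 0 < t \<Longrightarrow> x1 \<in> \<Omega> \<Longrightarrow> (\<And>x. q x - t * p x \<le> q x1 - t * p x1) \<Longrightarrow> 0 < r \<Longrightarrow>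
       - 2 * \<mu> * (q x1 - t * p x1) \<le> lam * truncated_laplacian s r R (\<lambda>x. q x - t * p x) x1"
  shows "\<exists>T>0. \<forall>x. q x = T * p x"
proof -
  obtain \<epsilon> r R where \<epsilon>: "0 < \<epsilon>" and r: "0 < r"
    and mass: "\<And>E::'a set. E \<in> lmeasurable \<Longrightarrow> measure lebesgue E \<le> \<epsilon> \<Longrightarrow>
      2 * \<bar>\<mu>\<bar> / lam < (LINT z|lebesgue. indicator (annulus r R - E) z * riesz s z)"
    using annulus_mass_large[OF s, where m = "2 * \<bar>\<mu>\<bar> / lam" and 'a = 'a] by blast
  let ?A = "(annulus r R :: 'a set)"
  obtain K where "closed K" and K: "K \<subseteq> \<Omega>" "\<Omega> - K \<in> lmeasurable" "emeasure lebesgue (\<Omega> - K) < ennreal \<epsilon>"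
    using sets_lebesgue_inner_closed[of \<Omega> \<epsilon>] \<Omega> \<epsilon> by (metis borel_open lborelD sets_completionI_sets)
  then have cK: "compact K"
    using \<Omega>(2) bounded_subset compact_eq_bounded_closed by blast
  have mK: "measure lebesgue (\<Omega> - K) \<le> \<epsilon>"
    using K(3) \<epsilon> by (simp add: measure_def enn2real_leI less_imp_le)
  have pK: "0 < p x" if "x \<in> K" for x using p(2) K(1) that by blast
  have p0: "0 \<le> p x" for x using p(2,3)[of x] by (cases "x \<in> \<Omega>") auto
  have cw: "continuous_on UNIV (\<lambda>x. q x - t * p x)" for t
    using p(1) q(1) by (intro continuous_intros)
  \<comment> \<open>Maximum principle for \<open>q - t * p\<close> in the small set \<open>\<Omega> - K\<close>.\<close>
  have narrow: "q y \<le> t * p y" if t: "0 < t" and tK: "\<And>x. x \<in> K \<Longrightarrow> q x \<le> t * p x" for t y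
  proof (rule ccontr)
    assume neg: "\<not> q y \<le> t * p y"
    define w where "w = (\<lambda>x. q x - t * p x)"
    have off: "w x \<le> 0" if "x \<notin> \<Omega> - K" for x
      using that tK[of x] p(3)[of x] q(2)[of x] by (auto simp: w_def)
    have "compact (closure \<Omega>)" "closure \<Omega> \<noteq> {}" using \<Omega> q(3) by auto
    moreover have "continuous_on (closure \<Omega>) w"
      using cw[of t] unfolding w_def by (rule continuous_on_subset) simp
    ultimately obtain x1 where x1: "x1 \<in> closure \<Omega>" "\<And>x. x \<in> closure \<Omega> \<Longrightarrow> w x \<le> w x1"
      using continuous_attains_sup[of "closure \<Omega>" w] by blast
    have wy: "0 < w y" using neg by (simp add: w_def)
    then have "y \<in> \<Omega>" using off[of y] by (cases "y \<in> \<Omega>") auto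
    then have "w y \<le> w x1" using x1(2) closure_subset by blast
    then have M: "0 < w x1" using wy by simp
    then have x1\<Omega>: "x1 \<in> \<Omega>" using off[of x1] by (cases "x1 \<in> \<Omega>") auto
    have max: "w x \<le> w x1" for x
    proof (cases "x \<in> closure \<Omega>")
      case False
      then have "w x \<le> 0" using off[of x] closure_subset by blast
      then show ?thesis using M by simp
    qed (rule x1(2))
    \<comment> \<open>\<open>E\<close> consists of the increments \<open>z\<close> for which \<open>x1 + z\<close> stays in the small set; for all others \<open>w\<close> drops by at least \<open>w x1\<close>.\<close>
    define E where "E = (+) (- x1) ` (\<Omega> - K)"
    have E: "E \<in> lmeasurable" "measure lebesgue E \<le> \<epsilon>"
      unfolding E_def measure_translation using measurable_translation[OF K(2)] mK by blast+
    have intE: "integrable lebesgue (\<lambda>z. indicator (?A - E) z * riesz s z)"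
    proof -
      have "?A \<in> sets borel" by measurable
      then have "?A - E \<in> sets lebesgue" using E(1) by (intro sets.Diff) auto
      then have "integrable lebesgue (\<lambda>z. indicator (?A - E) z *\<^sub>R (indicator ?A z * riesz s z))"
        by (intro integrable_mult_indicator annulus_mass_integrable s r)
      also have "(\<lambda>z. indicator (?A - E) z *\<^sub>R (indicator ?A z * riesz s z)) = (\<lambda>z. indicator (?A - E) z * riesz s z)"
        by (auto simp: indicator_def)
      finally show ?thesis .
    qed
    have le: "indicator ?A z * second_diff w x1 z * riesz s z \<le> - w x1 * (indicator (?A - E) z * riesz s z)" for z
    proof -
      consider "z \<notin> ?A" | "z \<in> ?A" "z \<in> E" | "z \<in> ?A" "z \<notin> E" by blast
      then show ?thesis
      proof cases
        case 2
        have "second_diff w x1 z \<le> 0" using max[of "x1 + z"] max[of "x1 - z"] by (simp add: second_diff_def)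
        then show ?thesis using 2 riesz_nonneg[of s z] by (simp add: mult_nonpos_nonneg)
      next
        case 3
        have "x1 + z \<notin> \<Omega> - K"
        proof
          assume "x1 + z \<in> \<Omega> - K"
          then have "z \<in> E" unfolding E_def by (intro image_eqI[of _ _ "x1 + z"]) simp_all
          then show False using 3 by blast
        qed
        then have "second_diff w x1 z \<le> - w x1"
          using off[of "x1 + z"] max[of "x1 - z"] by (simp add: second_diff_def)
        from mult_right_mono[OF this riesz_nonneg[of s z]] show ?thesis using 3 by simp
      qed (auto simp: indicator_def)
    qed
    have "- 2 * \<mu> * w x1 \<le> lam * (LINT z|lebesgue. indicator ?A z * second_diff w x1 z * riesz s z)"
      using ineq[OF t x1\<Omega> _ r, of R] max unfolding w_def by blast
    also have "\<dots> \<le> lam * (LINT z|lebesgue. - w x1 * (indicator (?A - E) z * riesz s z))"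
      using lam le intE second_diff_annulus_integrable[OF s _ r, of w] cw[of t]
      by (intro mult_left_mono integral_mono integrable_mult_right) (auto simp: w_def)
    also have "\<dots> = - w x1 * (lam * (LINT z|lebesgue. indicator (?A - E) z * riesz s z))"
      by simp
    also have "\<dots> < - w x1 * (2 * \<bar>\<mu>\<bar>)"
      using mass[OF E] M lam by (simp add: field_simps)
    finally have "w x1 * (2 * \<bar>\<mu>\<bar>) < w x1 * (2 * \<mu>)" by (simp add: algebra_simps)
    then show False using M by simp
  qed
  define S where "S = {t. 0 < t \<and> (\<forall>x. q x \<le> t * p x)}"
  define T where "T = Inf S"
  have "S \<noteq> {}"
  proof -
    obtain b where b: "\<And>x. x \<in> K \<Longrightarrow> q x \<le> b * p x"
      using compact_ratio_bound[OF cK p(1) q(1) pK] by blast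
    have "q x \<le> max b 1 * p x" if "x \<in> K" for x
      using b[OF that] mult_right_mono[of b "max b 1", OF _ p0[of x]] by linarith
    then have "max b 1 \<in> S" using narrow[of "max b 1"] by (auto simp: S_def)
    then show ?thesis by blast
  qed
  have ratio: "q x / p x \<le> T" if "x \<in> \<Omega>" for x
    unfolding T_def using \<open>S \<noteq> {}\<close> p(2)[OF that]
    by (intro cInf_greatest) (auto simp: S_def pos_divide_le_eq)
  have T: "0 < T" using ratio[OF q(3)] q(4) p(2)[OF q(3)] by (smt (verit) divide_pos_pos)
  have qT: "q x \<le> T * p x" for x
  proof (cases "x \<in> \<Omega>")
    case True
    then show ?thesis using ratio[OF True] p(2)[OF True] by (simp add: pos_divide_le_eq)
  next
    case False
    then show ?thesis using p(3)[OF False] q(2)[OF False] by simp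
  qed
  have "\<exists>x1\<in>K. q x1 = T * p x1"
  proof (rule ccontr)
    assume "\<not> ?thesis"
    then have less: "q x < T * p x" if "x \<in> K" for x using qT[of x] that by fastforce
    obtain b where b: "\<And>x. x \<in> K \<Longrightarrow> q x \<le> b * p x"
      "\<And>T. (\<And>x. x \<in> K \<Longrightarrow> q x < T * p x) \<Longrightarrow> 0 < T \<Longrightarrow> b < T"
      using compact_ratio_bound[OF cK p(1) q(1) pK] by blast
    \<comment> \<open>\<open>T / 2\<close> only keeps the new slope positive when \<open>b \<le> 0\<close>.\<close>
    define T' where "T' = max b (T / 2)"
    have T': "0 < T'" "T' < T" using T b(2)[OF less] by (auto simp: T'_def)
    have "q x \<le> T' * p x" if "x \<in> K" for x
      using b(1)[OF that] mult_right_mono[of b T', OF _ p0[of x]] by (simp add: T'_def)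
    then have "T' \<in> S" using narrow[of T'] T'(1) by (auto simp: S_def)
    moreover have "bdd_below S" by (rule bdd_belowI[of _ 0]) (auto simp: S_def)
    ultimately have "T \<le> T'" unfolding T_def by (rule cInf_lower)
    then show False using T' by simp
  qed
  then obtain x1 where x1: "x1 \<in> K" "q x1 = T * p x1" by blast
  have "q x - T * p x = 0" for x
  proof (rule vanishes_of_touching_zero[OF s cw, where ?x1.0 = x1])
    show "q x - T * p x \<le> 0" for x using qT by simp
    show "q x1 - T * p x1 = 0" using x1 by simp
    fix r R :: real assume r: "0 < r"
    have "0 \<le> lam * truncated_laplacian s r R (\<lambda>x. q x - T * p x) x1"
      using ineq[OF T, of x1 r R] x1 K(1) r qT by auto
    then show "0 \<le> truncated_laplacian s r R (\<lambda>x. q x - T * p x) x1"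
      using lam by (simp add: zero_le_mult_iff)
  qed
  then show ?thesis using T by auto
qed

section \<open>Sub- and supersolutions of the eigenvalue equation\<close>

lemma uniformly_continuous_of_bounded_support:
  fixes p :: "'a::euclidean_space \<Rightarrow> real"
  assumes p: "continuous_on UNIV p" and \<Omega>: "bounded \<Omega>" "\<And>x. x \<notin> \<Omega> \<Longrightarrow> p x = 0"
  shows "uniformly_continuous_on UNIV p"
unfolding uniformly_continuous_on_def
proof (intro allI impI)
  fix e :: real assume e: "0 < e"
  obtain B where B: "\<And>x. x \<in> \<Omega> \<Longrightarrow> norm x \<le> B" using \<Omega>(1) bounded_iff by blast
  have "uniformly_continuous_on (cball 0 (B + 1)) p"
    using p by (intro compact_uniformly_continuous) (auto intro: continuous_on_subset)
  from uniformly_continuous_onE[OF this e] obtain d where d: "0 < d"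
    "\<And>x x'. x \<in> cball 0 (B + 1) \<Longrightarrow> x' \<in> cball 0 (B + 1) \<Longrightarrow> dist x' x < d \<Longrightarrow> dist (p x') (p x) < e"
    by blast
  have "dist (p x') (p x) < e" if xx: "dist x' x < min d 1" for x x'
  proof (cases "x \<in> \<Omega> \<or> x' \<in> \<Omega>")
    case True
    have "norm x \<le> norm x' + dist x' x" "norm x' \<le> norm x + dist x' x"
      using norm_triangle_ineq2[of x x'] norm_triangle_ineq2[of x' x]
      by (simp_all add: dist_norm norm_minus_commute)
    then have "x \<in> cball 0 (B + 1)" "x' \<in> cball 0 (B + 1)"
      using True B[of x] B[of x'] xx by auto
    then show ?thesis using d(2) xx by simp
  qed (use \<Omega>(2) e in auto)
  then show "\<exists>d>0. \<forall>x\<in>UNIV. \<forall>x'\<in>UNIV. dist x' x < d \<longrightarrow> dist (p x') (p x) < e"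
    using d(1) by (intro exI[of _ "min d 1"]) auto
qed

lemma L1_omega_of_bounded_support:
  fixes p :: "'a::euclidean_space \<Rightarrow> real"
  assumes p: "continuous_on UNIV p" and \<Omega>: "bounded \<Omega>" "\<And>x. x \<notin> \<Omega> \<Longrightarrow> p x = 0"
  shows "p \<in> L1_omega s"
proof -
  let ?h = "\<lambda>y. p y * (1 + norm y) powr (- (real DIM('a) + 2 * s))"
  have pos: "1 + norm y \<noteq> 0" for y :: 'a by (metis add_pos_nonneg less_irrefl norm_ge_zero zero_less_one)
  have h: "continuous_on UNIV ?h" using p pos by (intro continuous_intros) auto
  then have [measurable]: "?h \<in> borel_measurable borel" by (rule borel_measurable_continuous_onI)
  have "integrable lborel (\<lambda>x. indicator (closure \<Omega>) x *\<^sub>R ?h x)"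
    using \<Omega>(1) h by (intro borel_integrable_compact) (auto intro: continuous_on_subset)
  also have "(\<lambda>x. indicator (closure \<Omega>) x *\<^sub>R ?h x) = ?h"
    using \<Omega>(2) closure_subset[of \<Omega>] by (force simp: indicator_def)
  finally show ?thesis by (simp add: L1_omega_def integrable_lebesgue_iff_lborel)
qed

lemma (in stable_operators) paraboloid_super_cmult:
  assumes u: "continuous_on UNIV u" "u \<in> L1_omega s" and super: "paraboloid_super \<L> \<Omega> u f" and t: "0 < t"
  shows "paraboloid_super \<L> \<Omega> (\<lambda>x. t * u x) (\<lambda>x. t * f x)"
  unfolding paraboloid_super_def
proof (intro ballI allI impI, elim conjE)
  fix x0 b c \<delta>
  assume x0: "x0 \<in> \<Omega>" and d: "0 < \<delta>" and sub: "ball x0 \<delta> \<subseteq> \<Omega>"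
    and lt: "\<forall>x\<in>ball x0 \<delta> - {x0}. quadratic (t * u x0) b c x0 x < t * u x"
  let ?w = "glue u x0 (b /\<^sub>R t) (c / t) \<delta>"
  have g: "glue (\<lambda>x. t * u x) x0 b c \<delta> = (\<lambda>x. t * ?w x)"
    using t by (intro glue_cmult) simp
  have I: "I_op \<L> ?w x0 \<le> f x0"
    using super x0 d sub lt t unfolding paraboloid_super_def by (simp add: quadratic_cmult)
  show "I_op \<L> (glue (\<lambda>x. t * u x) x0 b c \<delta>) x0 \<le> t * f x0"
    unfolding I_op_def g
  proof (rule cSUP_least[OF LL(2)])
    fix L assume L: "L \<in> \<L>"
    then obtain k where k: "L = L_op s k" using LL by (auto simp: L_star_def)
    have "L ?w x0 \<le> f x0"
      using le_I_op_glue[OF u d L] I by (rule order_trans)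
    then show "L (\<lambda>x. t * ?w x) x0 \<le> t * f x0" using t by (simp add: k L_op_cmult)
  qed
qed

lemma (in stable_operators) paraboloid_sub_cmult:
  assumes u: "continuous_on UNIV u" "u \<in> L1_omega s" and subs: "paraboloid_sub \<L> \<Omega> u f" and t: "0 < t"
  shows "paraboloid_sub \<L> \<Omega> (\<lambda>x. t * u x) (\<lambda>x. t * f x)"
  unfolding paraboloid_sub_def
proof (intro ballI allI impI, elim conjE)
  fix x0 b c \<delta>
  assume x0: "x0 \<in> \<Omega>" and d: "0 < \<delta>" and sub: "ball x0 \<delta> \<subseteq> \<Omega>"
    and lt: "\<forall>x\<in>ball x0 \<delta> - {x0}. t * u x < quadratic (t * u x0) b c x0 x"
  let ?w = "glue u x0 (b /\<^sub>R t) (c / t) \<delta>" and ?g = "glue (\<lambda>x. t * u x) x0 b c \<delta>"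
  have g: "?g = (\<lambda>x. t * ?w x)"
    using t by (intro glue_cmult) simp
  have "f x0 \<le> I_op \<L> ?w x0"
    using subs x0 d sub lt t unfolding paraboloid_sub_def by (simp add: quadratic_cmult)
  also have "\<dots> \<le> I_op \<L> ?g x0 / t"
    unfolding I_op_def[of _ ?w]
  proof (rule cSUP_least[OF LL(2)])
    fix L assume L: "L \<in> \<L>"
    then obtain k where k: "L = L_op s k" using LL by (auto simp: L_star_def)
    have "L ?g x0 \<le> I_op \<L> ?g x0"
      using u by (intro le_I_op_glue[OF _ _ d L] L1_omega_cmult continuous_intros)
    then have "t * L ?w x0 \<le> I_op \<L> ?g x0" unfolding g k L_op_cmult .
    then show "L ?w x0 \<le> I_op \<L> ?g x0 / t" using t by (simp add: pos_le_divide_eq mult.commute)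
  qed
  finally show "t * f x0 \<le> I_op \<L> ?g x0" using t by (simp add: pos_le_divide_eq mult.commute)
qed

text \<open>A paraboloid that touches \<open>0\<close> from above at its centre has \<open>c \<ge> 0\<close>, hence nonnegative second
  differences.\<close>

lemma (in stable_operators) paraboloid_sub_0:
  fixes \<Omega> :: "'a::euclidean_space set"
  shows "paraboloid_sub \<L> \<Omega> (\<lambda>_. 0) (\<lambda>_. 0)"
  unfolding paraboloid_sub_def
proof (intro ballI allI impI, elim conjE)
  fix x0 :: 'a and b c \<delta>
  assume d: "0 < \<delta>" and lt: "\<forall>x\<in>ball x0 \<delta> - {x0}. 0 < quadratic 0 b c x0 x"
  have c: "0 \<le> c"
  proof -
    obtain h :: 'a where h: "norm h = \<delta> / 2" using vector_choose_size[of "\<delta> / 2"] d by auto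
    have "h \<noteq> 0" using h d by auto
    then have "0 < quadratic 0 b c x0 (x0 + h)" "0 < quadratic 0 b c x0 (x0 - h)"
      using h d by (auto intro!: bspec[OF lt] simp: dist_norm)
    then have "0 < c * (norm h)\<^sup>2" by (simp add: quadratic_def)
    then show ?thesis by (simp add: zero_less_mult_iff)
  qed
  obtain L where L: "L \<in> \<L>" using LL by blast
  then obtain k where k: "k \<in> kernel_class lam Lam" "L = L_op s k"
    using LL by (auto simp: L_star_def)
  have "0 \<le> L (glue (\<lambda>_. 0) x0 b c \<delta>) x0"
  proof -
    have "AE z in lebesgue. 0 \<le> glued_diff (\<lambda>_. 0) x0 c \<delta> z * hom_kernel s k z"
      using hom_kernel_bounds[OF k(1)]
    proof eventually_elim
      fix z :: 'a assume K: "lam * riesz s z \<le> hom_kernel s k z \<and> hom_kernel s k z \<le> Lam * riesz s z"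
      have "0 \<le> lam * riesz s z" using lam riesz_nonneg[of s z] by simp
      then show "0 \<le> glued_diff (\<lambda>_. 0) x0 c \<delta> z * hom_kernel s k z"
        using K c by (simp add: glued_diff_def second_diff_def)
    qed
    then show ?thesis unfolding k(2) L_op_glue[OF d] by (simp add: integral_nonneg_AE)
  qed
  also have "\<dots> \<le> I_op \<L> (glue (\<lambda>_. 0) x0 b c \<delta>) x0"
    by (rule le_I_op_glue[OF _ _ d L]) (auto simp: L1_omega_def)
  finally show "0 \<le> I_op \<L> (glue (\<lambda>_. 0) x0 b c \<delta>) x0" .
qed

text \<open>At an interior zero of \<open>u\<close>, the difference of the subsolution \<open>0\<close> and the supersolution \<open>u\<close> has a
  maximum.\<close>

lemma (in stable_operators) strong_minimum_principle:
  fixes u :: "'a::euclidean_space \<Rightarrow> real"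
  assumes \<Omega>: "open \<Omega>" and u: "continuous_on UNIV u" "u \<in> L1_omega s"
    and super: "paraboloid_super \<L> \<Omega> u (\<lambda>x. - \<mu> * u x)"
    and nonneg: "\<And>x. 0 \<le> u x" and x0: "u x0 \<noteq> 0" and x: "x \<in> \<Omega>"
  shows "0 < u x"
proof (rule ccontr)
  assume "\<not> 0 < u x"
  then have ux: "u x = 0" using nonneg[of x] by simp
  have "0 - u x0 = 0"
  proof (rule vanishes_of_touching_zero[OF s, where ?x1.0 = x])
    show "continuous_on UNIV (\<lambda>x. 0 - u x)" using u(1) by (intro continuous_intros)
    show "0 - u y \<le> 0" for y using nonneg by simp
    show "0 - u x = 0" using ux by simp
    fix r R :: real assume r: "0 < r"
    have "2 * (0 - (- \<mu> * u x)) \<le> lam * truncated_laplacian s r R (\<lambda>x. 0 - u x) x"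
    proof (rule max_point_inequality[OF _ _ u paraboloid_sub_0 super _ _ _ \<Omega> x _ r])
      show "continuous_on UNIV (\<lambda>x. - \<mu> * u x)" using u(1) by (intro continuous_intros)
      show "0 - u y \<le> 0 - u x" for y using nonneg ux by simp
      show "uniformly_continuous_on UNIV (\<lambda>_::'a. 0::real) \<or> uniformly_continuous_on UNIV u"
        by (simp add: uniformly_continuous_on_const)
    qed (auto simp: L1_omega_def)
    then show "0 \<le> truncated_laplacian s r R (\<lambda>x. 0 - u x) x"
      using lam ux by (simp add: zero_le_mult_iff)
  qed
  then show False using x0 by simp
qed

lemma (in stable_operators) subsolution_proportional:
  fixes p q :: "'a::euclidean_space \<Rightarrow> real"
  assumes \<Omega>: "open \<Omega>" "bounded \<Omega>"
    and p: "continuous_on UNIV p" "\<And>x. x \<in> \<Omega> \<Longrightarrow> 0 < p x" "\<And>x. x \<notin> \<Omega> \<Longrightarrow> p x = 0"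
    and q: "continuous_on UNIV q" "q \<in> L1_omega s" "\<And>x. x \<notin> \<Omega> \<Longrightarrow> q x \<le> 0" "x0 \<in> \<Omega>" "0 < q x0"
    and super: "paraboloid_super \<L> \<Omega> p (\<lambda>x. - \<mu> * p x)"
    and sub: "paraboloid_sub \<L> \<Omega> q (\<lambda>x. - \<mu> * q x)"
  shows "\<exists>T>0. \<forall>x. q x = T * p x"
proof (rule proportional_of_max_inequality[OF s lam(1) \<Omega> p q(1) q(3-5), where \<mu> = \<mu>])
  fix t r R :: real and x1 :: 'a
  assume t: "0 < t" and x1: "x1 \<in> \<Omega>" and max: "\<And>x. q x - t * p x \<le> q x1 - t * p x1" and r: "0 < r"
  have tp: "continuous_on UNIV (\<lambda>x. t * p x)" using p(1) by (intro continuous_intros)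
  have rhs: "continuous_on UNIV (\<lambda>x. - \<mu> * q x)" "continuous_on UNIV (\<lambda>x. t * (- \<mu> * p x))"
    using p(1) q(1) by (auto intro!: continuous_intros)
  have pL: "p \<in> L1_omega s" by (rule L1_omega_of_bounded_support[OF p(1) \<Omega>(2) p(3)])
  have uc: "uniformly_continuous_on UNIV (\<lambda>x. t * p x)"
    using p(3) by (intro uniformly_continuous_of_bounded_support[OF tp \<Omega>(2)]) simp
  have "2 * ((- \<mu> * q x1) - t * (- \<mu> * p x1)) \<le> lam * truncated_laplacian s r R (\<lambda>x. q x - t * p x) x1"
    by (rule max_point_inequality[OF q(1,2) tp L1_omega_cmult[OF pL] sub
          paraboloid_super_cmult[OF p(1) pL super t] rhs disjI2[OF uc] \<Omega>(1) x1 max r])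
  then show "- 2 * \<mu> * (q x1 - t * p x1) \<le> lam * truncated_laplacian s r R (\<lambda>x. q x - t * p x) x1"
    by (simp add: algebra_simps)
qed

lemma (in stable_operators) supersolution_proportional:
  fixes p q :: "'a::euclidean_space \<Rightarrow> real"
  assumes \<Omega>: "open \<Omega>" "bounded \<Omega>"
    and p: "continuous_on UNIV p" "\<And>x. x \<in> \<Omega> \<Longrightarrow> p x < 0" "\<And>x. x \<notin> \<Omega> \<Longrightarrow> p x = 0"
    and q: "continuous_on UNIV q" "q \<in> L1_omega s" "\<And>x. x \<notin> \<Omega> \<Longrightarrow> 0 \<le> q x" "x0 \<in> \<Omega>" "q x0 < 0"
    and sub: "paraboloid_sub \<L> \<Omega> p (\<lambda>x. - \<mu> * p x)"
    and super: "paraboloid_super \<L> \<Omega> q (\<lambda>x. - \<mu> * q x)"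
  shows "\<exists>T>0. \<forall>x. q x = T * p x"
proof -
  have "\<exists>T>0. \<forall>x. - q x = T * - p x"
  proof (rule proportional_of_max_inequality[OF s lam(1) \<Omega>, where \<mu> = \<mu>])
    show "continuous_on UNIV (\<lambda>x. - p x)" "continuous_on UNIV (\<lambda>x. - q x)"
      using p q by (auto intro: continuous_intros)
    show "x \<in> \<Omega> \<Longrightarrow> 0 < - p x" "x \<notin> \<Omega> \<Longrightarrow> - p x = 0" "x \<notin> \<Omega> \<Longrightarrow> - q x \<le> 0" for x
      using p q by auto
    show "x0 \<in> \<Omega>" "0 < - q x0" using q by auto
    fix t r R :: real and x1 :: 'a
    assume t: "0 < t" and x1: "x1 \<in> \<Omega>" and max: "\<And>x. - q x - t * - p x \<le> - q x1 - t * - p x1" and r: "0 < r"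
    have tp: "continuous_on UNIV (\<lambda>x. t * p x)" using p(1) by (intro continuous_intros)
    have rhs: "continuous_on UNIV (\<lambda>x. - \<mu> * q x)" "continuous_on UNIV (\<lambda>x. t * (- \<mu> * p x))"
      using p(1) q(1) by (auto intro!: continuous_intros)
    have pL: "p \<in> L1_omega s" by (rule L1_omega_of_bounded_support[OF p(1) \<Omega>(2) p(3)])
    have uc: "uniformly_continuous_on UNIV (\<lambda>x. t * p x)"
      using p(3) by (intro uniformly_continuous_of_bounded_support[OF tp \<Omega>(2)]) simp
    have max': "t * p x - q x \<le> t * p x1 - q x1" for x using max[of x] by simp
    have *: "2 * (t * (- \<mu> * p x1) - (- \<mu> * q x1)) \<le> lam * truncated_laplacian s r R (\<lambda>x. t * p x - q x) x1"
      by (rule max_point_inequality[OF tp L1_omega_cmult[OF pL] q(1,2)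
            paraboloid_sub_cmult[OF p(1) pL sub t] super rhs(2,1) disjI1[OF uc] \<Omega>(1) x1 max' r])
    have eq: "(\<lambda>x. - q x - t * - p x) = (\<lambda>x. t * p x - q x)" by auto
    have eq1: "- 2 * \<mu> * (- q x1 - t * - p x1) = 2 * (t * (- \<mu> * p x1) - (- \<mu> * q x1))"
      by (simp add: algebra_simps)
    show "- 2 * \<mu> * (- q x1 - t * - p x1) \<le> lam * truncated_laplacian s r R (\<lambda>x. - q x - t * - p x) x1"
      unfolding eq eq1 by (rule *)
  qed
  then show ?thesis by auto
qed

theorem theorem1p2:
  fixes s lam Lam :: real
    and \<L> :: "(('a::euclidean_space \<Rightarrow> real) \<Rightarrow> 'a \<Rightarrow> real) set"
    and \<Omega> :: "'a set"
    and \<Psi>p \<Psi>m :: "'a \<Rightarrow> real"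
  assumes "0 < s" "s < 1"
    and "0 < lam" "lam \<le> Lam"
    and "\<L> \<subseteq> L_star s lam Lam" "\<L> \<noteq> {}"
    and "smooth_bounded_domain \<Omega>"
    and "eigenfunction_plus s \<L> \<Omega> \<Psi>p"
    and "eigenfunction_minus s \<L> \<Omega> \<Psi>m"
  shows "(\<forall>u. continuous_on UNIV u \<and> u \<in> L1_omega s \<and>
            (visc_eq \<L> \<Omega> u (\<lambda>x. - Lambda_plus s \<L> \<Omega> * u x) \<and> (\<forall>x. x \<notin> \<Omega> \<longrightarrow> u x = 0)
             \<or> visc_ge \<L> \<Omega> u (\<lambda>x. - Lambda_plus s \<L> \<Omega> * u x) \<and>
               (\<exists>x0\<in>\<Omega>. u x0 > 0) \<and> (\<forall>x. x \<notin> \<Omega> \<longrightarrow> u x \<le> 0))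
            \<longrightarrow> (\<exists>t. \<forall>x. u x = t * \<Psi>p x))
       \<and> (\<forall>u. continuous_on UNIV u \<and> u \<in> L1_omega s \<and>
            (visc_eq \<L> \<Omega> u (\<lambda>x. - Lambda_minus s \<L> \<Omega> * u x) \<and> (\<forall>x. x \<notin> \<Omega> \<longrightarrow> u x = 0)
             \<or> visc_le \<L> \<Omega> u (\<lambda>x. - Lambda_minus s \<L> \<Omega> * u x) \<and>
               (\<exists>x0\<in>\<Omega>. u x0 < 0) \<and> (\<forall>x. x \<notin> \<Omega> \<longrightarrow> u x \<ge> 0))
            \<longrightarrow> (\<exists>t. \<forall>x. u x = t * \<Psi>m x))"
    (is "(\<forall>u. ?hyp_p u \<longrightarrow> ?concl_p u) \<and> (\<forall>u. ?hyp_m u \<longrightarrow> ?concl_m u)")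
proof -
  interpret stable_operators s lam Lam \<L> using assms(1-6) by unfold_locales
  have \<Omega>: "open \<Omega>" "bounded \<Omega>" "\<Omega> \<noteq> {}"
    using assms(7) by (auto simp: smooth_bounded_domain_def)
  define \<mu>p where "\<mu>p = Lambda_plus s \<L> \<Omega>"
  define \<mu>m where "\<mu>m = Lambda_minus s \<L> \<Omega>"
  note sub = visc_ge_imp_paraboloid_sub and super = visc_le_imp_paraboloid_super
  have neg_sub: "paraboloid_sub \<L> \<Omega> (\<lambda>x. - u x) (\<lambda>x. - \<mu> * - u x)"
    if "continuous_on UNIV u" "u \<in> L1_omega s" "visc_le \<L> \<Omega> u (\<lambda>x. - \<mu> * u x)" for u \<mu>
    using paraboloid_sub_uminus[OF that(1,2) super[OF that(3)]] by simp
  have p: "continuous_on UNIV \<Psi>p" "\<And>x. x \<in> \<Omega> \<Longrightarrow> 0 < \<Psi>p x" "\<And>x. x \<notin> \<Omega> \<Longrightarrow> \<Psi>p x = 0"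
    "visc_le \<L> \<Omega> \<Psi>p (\<lambda>x. - \<mu>p * \<Psi>p x)"
    using assms(8) by (auto simp: eigenfunction_plus_def C_zero_def visc_eq_def \<mu>p_def)
  have m: "continuous_on UNIV \<Psi>m" "\<And>x. x \<in> \<Omega> \<Longrightarrow> \<Psi>m x < 0" "\<And>x. x \<notin> \<Omega> \<Longrightarrow> \<Psi>m x = 0"
    "visc_ge \<L> \<Omega> \<Psi>m (\<lambda>x. - \<mu>m * \<Psi>m x)" "visc_le \<L> \<Omega> \<Psi>m (\<lambda>x. - \<mu>m * \<Psi>m x)"
    using assms(9) by (auto simp: eigenfunction_minus_def C_zero_def visc_eq_def \<mu>m_def)
  have mL: "\<Psi>m \<in> L1_omega s" by (rule L1_omega_of_bounded_support[OF m(1) \<Omega>(2) m(3)])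
  have plus: "\<exists>T>0. \<forall>x. q x = T * \<Psi>p x"
    if "continuous_on UNIV q" "q \<in> L1_omega s" "\<And>x. x \<notin> \<Omega> \<Longrightarrow> q x \<le> 0" "x0 \<in> \<Omega>" "0 < q x0"
      "paraboloid_sub \<L> \<Omega> q (\<lambda>x. - \<mu>p * q x)" for q x0
    using that by (intro subsolution_proportional[OF \<Omega>(1,2) p(1-3) _ _ _ _ _ super[OF p(4)]])
  have minus: "\<exists>T>0. \<forall>x. q x = T * \<Psi>m x"
    if "continuous_on UNIV q" "q \<in> L1_omega s" "\<And>x. x \<notin> \<Omega> \<Longrightarrow> 0 \<le> q x" "x0 \<in> \<Omega>" "q x0 < 0"
      "visc_le \<L> \<Omega> q (\<lambda>x. - \<mu>m * q x)" for q x0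
    using that(1-5) by (intro supersolution_proportional[OF \<Omega>(1,2) m(1-3) _ _ _ _ _ sub[OF m(4)] super[OF that(6)]])
  have part_p: "?concl_p u" if h: "?hyp_p u" for u
  proof -
    have u: "continuous_on UNIV u" "u \<in> L1_omega s" "visc_ge \<L> \<Omega> u (\<lambda>x. - \<mu>p * u x)"
      "\<And>x. x \<notin> \<Omega> \<Longrightarrow> u x \<le> 0"
      using h by (auto simp: visc_eq_def \<mu>p_def)
    consider (pos) x0 where "x0 \<in> \<Omega>" "0 < u x0"
      | (neg) x0 where "x0 \<in> \<Omega>" "u x0 < 0" "visc_le \<L> \<Omega> u (\<lambda>x. - \<mu>p * u x)" "\<And>x. x \<notin> \<Omega> \<Longrightarrow> u x = 0"
      | (zero) "\<And>x. u x = 0"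
      using h unfolding visc_eq_def \<mu>p_def by (metis linorder_neqE_linordered_idom)
    then show ?thesis
    proof cases
      case pos
      then show ?thesis using plus[OF u(1,2,4) pos sub[OF u(3)]] by blast
    next
      case neg
      have "\<exists>T>0. \<forall>x. - u x = T * \<Psi>p x"
        by (rule plus[OF _ L1_omega_uminus[OF u(2)] _ neg(1) _ neg_sub[OF u(1,2) neg(3)]])
          (use u(1) neg in \<open>auto intro: continuous_intros\<close>)
      then obtain T where "\<And>x. - u x = T * \<Psi>p x" by blast
      then have "u x = (- T) * \<Psi>p x" for x by (metis minus_equation_iff mult_minus_left)
      then show ?thesis by blast
    next
      case zero
      then show ?thesis by (intro exI[of _ 0]) simp
    qed
  qed
  have part_m: "?concl_m u" if h: "?hyp_m u" for u
  proof -
    have u: "continuous_on UNIV u" "u \<in> L1_omega s" "visc_le \<L> \<Omega> u (\<lambda>x. - \<mu>m * u x)"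
      "\<And>x. x \<notin> \<Omega> \<Longrightarrow> 0 \<le> u x"
      using h by (auto simp: visc_eq_def \<mu>m_def)
    consider (neg) x0 where "x0 \<in> \<Omega>" "u x0 < 0"
      | (pos) x0 where "x0 \<in> \<Omega>" "0 < u x0" "\<And>x. x \<in> \<Omega> \<Longrightarrow> 0 \<le> u x" "\<And>x. x \<notin> \<Omega> \<Longrightarrow> u x = 0"
      | (zero) "\<And>x. u x = 0"
      using h unfolding visc_eq_def \<mu>m_def by (metis linorder_neqE_linordered_idom not_less)
    then show ?thesis
    proof cases
      case neg
      then show ?thesis using minus[OF u(1,2,4) neg u(3)] by blast
    next
      case pos
      \<comment> \<open>\<open>- \<Psi>m\<close> is known to be a subsolution, so it is compared with \<open>u\<close>, which is a positive supersolution.\<close>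
      have nonneg: "0 \<le> u x" for x using pos(3)[of x] u(4)[of x] by blast
      have upos: "0 < u x" if "x \<in> \<Omega>" for x
        using pos(2) by (intro strong_minimum_principle[OF \<Omega>(1) u(1,2) super[OF u(3)] nonneg _ that, of x0]) simp
      have "\<exists>T>0. \<forall>x. - \<Psi>m x = T * u x"
        by (rule subsolution_proportional[OF \<Omega>(1,2) u(1) upos pos(4) _ L1_omega_uminus[OF mL] _ pos(1) _
              super[OF u(3)] neg_sub[OF m(1) mL m(5)]])
          (use m pos(1) in \<open>auto intro: continuous_intros\<close>)
      then obtain T where T: "0 < T" "\<And>x. - \<Psi>m x = T * u x" by blast
      have "u x = (- (1 / T)) * \<Psi>m x" for x
        using T(1) T(2)[of x] by (simp add: field_simps)
      then show ?thesis by blast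
    next
      case zero
      then show ?thesis by (intro exI[of _ 0]) simp
    qed
  qed
  show ?thesis using part_p part_m by blast
qed

end
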